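(* For all integers $n\ge 0$, $$\overline{R_{4,3}}(9n+3)\equiv 0 \pmod 6 \qquad\text{and}\qquad \overline{R_{4,3}}(12n+11)\equiv 0 \pmod 9.$$
   Context: An overpartition of a nonnegative integer $n$ is a partition of $n$ (a non-increasing sequence of positive integers summing to $n$) in which the first occurrence of each part size may be overlined. For coprime positive integers $\ell,\mu$, $\overline{R_{\ell,\mu}}(n)$ denotes the number of overpartitions of $n$ in which no part is divisible by $\ell$ or by $\mu$ (with $\overline{R_{\ell,\mu}}(0)=1$). Its generating function, for $|q|<1$, is $$\sum_{n\ge 0}\overline{R_{\ell,\mu}}(n)q^n=\prod_{n=1}^{\infty}\frac{(1+q^{n})(1-q^{\ell n})(1-q^{\mu n})(1+q^{\ell\mu n})}{(1-q^{n})(1+q^{\ell n})(1+q^{\mu n})(1-q^{\ell\mu n})}.$$ The claim concerns $(\ell,\mu)=(4,3)$. *)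

theory Defs
  imports Complex_Main "HOL-Number_Theory.Cong"
begin

text \<open>
  An overpartition of \<open>n\<close> is encoded as a pair \<open>(ps, S)\<close>: \<open>ps\<close> is the non-increasing list of its
  parts, and \<open>S\<close> is the set of those part sizes whose first occurrence in \<open>ps\<close> is overlined.  Since
  only the first occurrence of a size may be overlined, \<open>S\<close> determines the overlining.
\<close>

definition overpartitions :: "nat \<Rightarrow> (nat list \<times> nat set) set" where
  "overpartitions n =
    {(ps, S). sorted_wrt (\<ge>) ps \<and> (\<forall>p \<in> set ps. p > 0) \<and> sum_list ps = n \<and> S \<subseteq> set ps}"

definition overpartitions_regular :: "nat \<Rightarrow> nat \<Rightarrow> nat \<Rightarrow> (nat list \<times> nat set) set" where
  "overpartitions_regular l m n =
    {(ps, S) \<in> overpartitions n. \<forall>p \<in> set ps. \<not> l dvd p \<and> \<not> m dvd p}"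

definition Rbar :: "nat \<Rightarrow> nat \<Rightarrow> nat \<Rightarrow> nat" where
  "Rbar l m n = card (overpartitions_regular l m n)"

text \<open>Finiteness guarantees that \<open>card\<close> really counts (it is \<open>0\<close> on infinite sets).\<close>

lemma finite_overpartitions: "finite (overpartitions n)"
proof -
  have len: "length ps \<le> sum_list ps" if "\<forall>p \<in> set ps. p > 0" for ps :: "nat list"
    using that by (induction ps) auto
  have "overpartitions n \<subseteq> {ps. set ps \<subseteq> {..n} \<and> length ps \<le> n} \<times> Pow {..n}"
  proof
    fix x assume x: "x \<in> overpartitions n"
    obtain ps S where xe: "x = (ps, S)" by (cases x)
    have pos: "\<forall>p \<in> set ps. p > 0" and sum: "sum_list ps = n" and S: "S \<subseteq> set ps"
      using x by (auto simp: xe overpartitions_def)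
    have "set ps \<subseteq> {..n}" using member_le_sum_list[of _ ps] sum by auto
    with len[OF pos] sum S show "x \<in> {ps. set ps \<subseteq> {..n} \<and> length ps \<le> n} \<times> Pow {..n}"
      by (auto simp: xe)
  qed
  moreover have "finite {ps. set ps \<subseteq> {..n} \<and> length ps \<le> n}"
    by (rule finite_lists_length_le) simp
  ultimately show ?thesis by (meson finite_Pow_iff finite_SigmaI finite_atMost finite_subset)
qed

lemma finite_overpartitions_regular: "finite (overpartitions_regular l m n)"
  by (rule finite_subset[OF _ finite_overpartitions[of n]]) (auto simp: overpartitions_regular_def)

lemma Rbar_0: "Rbar l m 0 = 1"
proof -
  have nil: "ps = []" if "\<forall>p \<in> set ps. p > 0" "sum_list ps = 0" for ps :: "nat list"
    using that by (cases ps) auto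
  have "x = ([], {})" if x: "x \<in> overpartitions_regular l m 0" for x
  proof -
    obtain ps S where xe: "x = (ps, S)" by (cases x)
    have pos: "\<forall>p \<in> set ps. p > 0" and sum: "sum_list ps = 0" and S: "S \<subseteq> set ps"
      using x by (simp_all add: xe overpartitions_regular_def overpartitions_def)
    show ?thesis using nil[OF pos sum] S by (simp add: xe)
  qed
  moreover have "([], {}) \<in> overpartitions_regular l m 0"
    by (simp add: overpartitions_regular_def overpartitions_def)
  ultimately have "overpartitions_regular l m 0 = {([], {})}" by blast
  then show ?thesis by (simp add: Rbar_def)
qed

end

theory Submission
  imports Defs "HOL-Computational_Algebra.Formal_Power_Series"
begin

text \<open>
  Let \<open>G\<close> be the generating function of \<open>Rbar 4 3\<close>.  Gauss's identity says that the generating function of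
  all overpartitions is \<open>1 / \<phi>(-q)\<close>, where \<open>\<phi>(q) = \<Sum>x. q^(x^2)\<close>; sums extend over all
  integers unless restricted.  Sorting part sizes by divisibility yields \<open>G \<phi>(-q) \<phi>(-q^12) = \<phi>(-q^4) \<phi>(-q^3)\<close> (\<open>Rbar_gf_theta\<close>).  From here on only theta
  series with integer coefficients occur.

  Three tools are combined.  First, \<open>F(q)^3 \<equiv> F(q^3)\<close> modulo 3 for every integral series.  Second, a factor
  that is a series in \<open>q^k\<close> and has constant term 1 does not influence whether the coefficients in a
  fixed residue class modulo \<open>k\<close> are all divisible by some number.  Third, \<open>\<phi>\<close> and
  \<open>\<psi>(q) = \<Sum>y\<ge>0. q^(y(y+1)/2)\<close> have simple 2- and 3-dissections, in which two further series appear,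
  \<open>\<Omega>(q) = \<Sum>x. q^(3x^2 - 2x)\<close> and \<open>P(q) = \<Sum>y. q^(y(3y+1)/2)\<close> (\<open>omega\<close> and \<open>pent\<close> below).  So one makes the
  denominator a series in \<open>q^k\<close>, extracts a residue class modulo \<open>k\<close> from the numerator, and repeats.

  What remains at the end are two facts about binary quadratic forms.  One is the congruence
  \<open>\<phi>(q) \<Omega>(q) \<equiv> P(q^2) \<psi>(q^2)\<close> modulo 3 (\<open>phi_mult_omega_cong\<close>), which comes from the rotation of order 3 of the
  form \<open>z^2 + 3 x^2\<close>.  The other is the identity \<open>\<phi>(-q^3) \<psi>(q^3) = P(q) \<Omega>(-q)\<close> (\<open>pent_mult_negate_X_omega\<close>), which comes
  from a rotation of \<open>8 X^2 + Y^2\<close>.  The congruence finishes the arguments \<open>12n + 11\<close> modulo 9 and the even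
  ones among \<open>9n + 3\<close> modulo 3; the identity finishes those congruent to 9 modulo 12.  The remaining
  \<open>9n + 3\<close> have the form \<open>4m + 3\<close>, where modulo 3 the odd part of \<open>G\<close> is \<open>q\<close> times a series in \<open>q^4\<close>.
  Modulo 2, \<open>G\<close> is 1.
\<close>

unbundle fps_syntax

section \<open>Dilations and residue classes of power series\<close>

definition dilate :: "nat \<Rightarrow> int fps \<Rightarrow> int fps" where
  "dilate k F = F oo fps_X ^ k"

definition section_fps :: "nat \<Rightarrow> nat \<Rightarrow> int fps \<Rightarrow> int fps" where
  "section_fps k r F = Abs_fps (\<lambda>n. F $ (k * n + r))"

definition negate_X :: "int fps \<Rightarrow> int fps" where
  "negate_X F = F oo (- fps_X)"

lemma section_fps_nth [simp]: "section_fps k r F $ n = F $ (k * n + r)"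
  by (simp add: section_fps_def)

lemma dilate_nth:
  assumes "k > 0"
  shows "dilate k F $ n = (if k dvd n then F $ (n div k) else 0)"
proof -
  have "dilate k F $ n = (\<Sum>i=0..n. if n = k * i then F $ i else 0)"
    unfolding dilate_def fps_compose_nth
    by (intro sum.cong) (simp_all add: flip: power_mult)
  also have "\<dots> = (\<Sum>i\<in>{i\<in>{0..n}. n = k * i}. F $ i)"
    by (rule sum.inter_filter[symmetric]) simp
  also have "{i\<in>{0..n}. n = k * i} = (if k dvd n then {n div k} else {})"
    using assms by auto
  finally show ?thesis by simp
qed

lemma dilate_simps [simp]:
  "dilate k 0 = 0" "dilate k 1 = 1" "dilate k (numeral w) = numeral w"
  "dilate k (F + G) = dilate k F + dilate k G"
  "dilate k (F - G) = dilate k F - dilate k G"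
  "dilate k (- F) = - dilate k F"
  by (simp_all add: dilate_def fps_compose_add_distrib fps_compose_sub_distrib fps_compose_uminus)

lemma dilate_mult [simp]: "k > 0 \<Longrightarrow> dilate k (F * G) = dilate k F * dilate k G"
  by (simp add: dilate_def fps_compose_mult_distrib)

lemma dilate_power [simp]: "k > 0 \<Longrightarrow> dilate k (F ^ n) = dilate k F ^ n"
  by (simp add: dilate_def fps_compose_power)

lemma dilate_prod: "k > 0 \<Longrightarrow> dilate k (\<Prod>a\<in>A. f a) = (\<Prod>a\<in>A. dilate k (f a))"
  by (simp add: dilate_def fps_compose_prod_distrib)

lemma dilate_X [simp]: "k > 0 \<Longrightarrow> dilate k fps_X = fps_X ^ k"
  by (simp add: dilate_def)

lemma dilate_dilate [simp]:
  "j > 0 \<Longrightarrow> k > 0 \<Longrightarrow> dilate j (dilate k F) = dilate (j * k) F"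
  by (auto simp: fps_eq_iff dilate_nth div_mult2_eq dvd_mult_imp_div)

lemma dilate_0 [simp]: "k > 0 \<Longrightarrow> dilate k F $ 0 = F $ 0"
  by (simp add: dilate_nth)

lemma dilate_inject [simp]: "k > 0 \<Longrightarrow> dilate k F = dilate k G \<longleftrightarrow> F = G"
proof
  assume k: "k > 0" and eq: "dilate k F = dilate k G"
  have "F $ n = G $ n" for n
    using arg_cong[OF eq, of "\<lambda>H. H $ (k * n)"] k by (simp add: dilate_nth)
  then show "F = G" by (simp add: fps_eq_iff)
qed simp

lemma negate_X_nth [simp]: "negate_X F $ n = (-1) ^ n * F $ n"
  by (simp add: negate_X_def fps_compose_uminus')

lemma negate_X_simps [simp]:
  "negate_X (numeral w) = numeral w" "negate_X 1 = 1"
  "negate_X (F + G) = negate_X F + negate_X G"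
  "negate_X (F - G) = negate_X F - negate_X G"
  "negate_X (- F) = - negate_X F"
  "negate_X (F * G) = negate_X F * negate_X G"
  "negate_X (F ^ n) = negate_X F ^ n"
  "negate_X fps_X = - fps_X"
  by (simp_all add: negate_X_def fps_compose_add_distrib fps_compose_sub_distrib fps_compose_uminus
      fps_compose_mult_distrib fps_compose_power)

lemma negate_X_dilate_even [simp]:
  "even k \<Longrightarrow> k > 0 \<Longrightarrow> negate_X (dilate k F) = dilate k F"
  by (auto simp: fps_eq_iff dilate_nth)

lemma negate_X_dilate_odd:
  "odd k \<Longrightarrow> negate_X (dilate k F) = dilate k (negate_X F)"
  by (auto simp: fps_eq_iff dilate_nth odd_pos) (auto elim!: dvdE simp: odd_pos power_mult)

lemma section_simps [simp]:
  "section_fps k r (F + G) = section_fps k r F + section_fps k r G"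
  "section_fps k r (F - G) = section_fps k r F - section_fps k r G"
  "section_fps k r (- F) = - section_fps k r F"
  "section_fps k r (numeral w * F) = numeral w * section_fps k r F"
  by (simp_all add: fps_eq_iff numeral_fps_const)

text \<open>
  A series in \<open>q^k\<close> passes through the extraction of a residue class modulo \<open>k\<close>.  In the congruence
  proofs this is what makes denominators harmless: whenever the modulus lets a theta series be
  replaced by one in \<open>q^k\<close>, it can be moved out and cancelled.
\<close>

lemma section_dilate_mult:
  assumes "r < k"
  shows "section_fps k r (dilate k F * G) = F * section_fps k r G"
proof (rule fps_ext)
  fix n
  have k: "k > 0" using assms by simp
  have sub: "(\<lambda>j. k * j) ` {0..n} \<subseteq> {0..k * n + r}"
    by (auto intro!: trans_le_add1 mult_le_mono2)
  have "section_fps k r (dilate k F * G) $ n = (\<Sum>i=0..k*n+r. dilate k F $ i * G $ (k*n+r-i))"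
    by (simp add: fps_mult_nth)
  also have "\<dots> = (\<Sum>i\<in>(\<lambda>j. k * j) ` {0..n}. dilate k F $ i * G $ (k*n+r-i))"
  proof (rule sum.mono_neutral_right[OF _ sub], simp, safe)
    fix i assume i: "i \<in> {0..k*n+r}" "i \<notin> (\<lambda>j. k * j) ` {0..n}"
    have "\<not> k dvd i"
    proof
      assume "k dvd i"
      then obtain j where j: "i = k * j" ..
      have "k * j < k * Suc n" using i(1) assms by (simp add: j)
      then have "j < Suc n" by (simp only: mult_less_cancel1)
      then have "j \<le> n" by simp
      then show False using i(2) j by auto
    qed
    then show "dilate k F $ i * G $ (k*n+r-i) = 0" by (simp add: dilate_nth k)
  qed
  also have "\<dots> = (\<Sum>j=0..n. F $ j * G $ (k * (n - j) + r))"
    using k by (subst sum.reindex)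
      (auto simp: inj_on_def dilate_nth diff_mult_distrib2 intro!: sum.cong)
  also have "\<dots> = (F * section_fps k r G) $ n"
    by (simp add: fps_mult_nth)
  finally show "section_fps k r (dilate k F * G) $ n = (F * section_fps k r G) $ n" .
qed

lemma section_mult_dilate:
  "r < k \<Longrightarrow> section_fps k r (G * dilate k F) = section_fps k r G * F"
  by (metis mult.commute section_dilate_mult)

lemma section_X_power_dilate:
  assumes "r < k" "s < k"
  shows "section_fps k r (fps_X ^ s * dilate k F) = (if r = s then F else 0)"
proof -
  have "section_fps k r (fps_X ^ s * dilate k F) = section_fps k r (fps_X ^ s) * F"
    by (rule section_mult_dilate[OF assms(1)])
  moreover have "section_fps k r (fps_X ^ s) = (if r = s then 1 else 0)"
  proof (rule fps_ext)
    fix n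
    have "k * n + r = s \<longleftrightarrow> n = 0 \<and> r = s"
      using assms by (cases n) auto
    then show "section_fps k r (fps_X ^ s) $ n = (if r = s then 1 else 0) $ n"
      by auto
  qed
  ultimately show ?thesis by simp
qed

text \<open>
  A series written as \<open>A(q^k) + q B(q^k) + ...\<close> is dissected modulo \<open>k\<close>, and the coefficients can be read
  off.  The following rules turn an identity of that shape, proved by algebra, into statements about
  the single residue classes.
\<close>

lemma sections_2:
  assumes "F = dilate 2 A + fps_X * dilate 2 B"
  shows "section_fps 2 0 F = A" "section_fps 2 1 F = B"
  using section_X_power_dilate[of _ 2 0] section_X_power_dilate[of _ 2 1]
  unfolding assms by simp_all

lemma sections_3:
  assumes "F = dilate 3 A + fps_X * dilate 3 B + fps_X ^ 2 * dilate 3 C"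
  shows "section_fps 3 0 F = A" "section_fps 3 1 F = B" "section_fps 3 2 F = C"
  using section_X_power_dilate[of _ 3 0] section_X_power_dilate[of _ 3 1]
    section_X_power_dilate[of _ 3 2]
  unfolding assms by simp_all

lemma sections_4:
  assumes "F = dilate 4 A + fps_X * dilate 4 B + fps_X ^ 2 * dilate 4 C + fps_X ^ 3 * dilate 4 D"
  shows "section_fps 4 3 F = D"
  using section_X_power_dilate[of 3 4 0] section_X_power_dilate[of 3 4 1]
    section_X_power_dilate[of 3 4 2] section_X_power_dilate[of 3 4 3]
  unfolding assms by simp

section \<open>Congruences between power series\<close>

definition fps_cong :: "int \<Rightarrow> int fps \<Rightarrow> int fps \<Rightarrow> bool" where
  "fps_cong m F G \<longleftrightarrow> (\<forall>n. [F $ n = G $ n] (mod m))"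

lemma fps_cong_iff_dvd: "fps_cong m F G \<longleftrightarrow> fps_const m dvd F - G"
proof
  assume "fps_cong m F G"
  then have "\<forall>n. \<exists>c. F $ n - G $ n = m * c"
    by (auto simp: fps_cong_def cong_iff_dvd_diff dvd_def)
  then obtain c where "\<And>n. F $ n - G $ n = m * c n" by metis
  then have "F - G = fps_const m * Abs_fps c" by (simp add: fps_eq_iff)
  then show "fps_const m dvd F - G" by simp
next
  assume "fps_const m dvd F - G"
  then obtain H where "F - G = fps_const m * H" ..
  then have "F $ n - G $ n = m * H $ n" for n
    by (metis fps_sub_nth fps_mult_left_const_nth)
  then show "fps_cong m F G" by (simp add: fps_cong_def cong_iff_dvd_diff)
qed

lemma fps_cong_3: "fps_cong 3 F G \<longleftrightarrow> 3 dvd F - G"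
  by (simp add: fps_cong_iff_dvd numeral_fps_const)

lemma fps_cong_3I: "F - G = 3 * H \<Longrightarrow> fps_cong 3 F G"
  by (simp only: fps_cong_3 dvd_triv_left)

lemma fps_cong_refl [simp]: "fps_cong m F F"
  by (simp add: fps_cong_def)

lemma fps_cong_sym: "fps_cong m F G \<Longrightarrow> fps_cong m G F"
  by (simp add: fps_cong_def cong_sym_eq)

lemma fps_cong_trans [trans]: "fps_cong m F G \<Longrightarrow> fps_cong m G H \<Longrightarrow> fps_cong m F H"
  by (auto simp: fps_cong_def intro: cong_trans)

lemma fps_cong_add: "fps_cong m F G \<Longrightarrow> fps_cong m F' G' \<Longrightarrow> fps_cong m (F + F') (G + G')"
  by (simp add: fps_cong_def cong_add)

lemma fps_cong_mult: "fps_cong m F G \<Longrightarrow> fps_cong m F' G' \<Longrightarrow> fps_cong m (F * F') (G * G')"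
  by (simp add: fps_cong_def fps_mult_nth cong_sum cong_mult)

lemma fps_cong_power: "fps_cong m F G \<Longrightarrow> fps_cong m (F ^ n) (G ^ n)"
  by (induction n) (simp_all add: fps_cong_mult)

lemma fps_cong_dilate: "fps_cong m F G \<Longrightarrow> k > 0 \<Longrightarrow> fps_cong m (dilate k F) (dilate k G)"
  by (simp add: fps_cong_def dilate_nth)

lemma fps_cong_section: "fps_cong m F G \<Longrightarrow> fps_cong m (section_fps k r F) (section_fps k r G)"
  by (simp add: fps_cong_def)

lemma fps_cong_negate_X: "fps_cong m F G \<Longrightarrow> fps_cong m (negate_X F) (negate_X G)"
  by (simp add: fps_cong_def cong_scalar_left)

text \<open>
  A series with constant term 1 is a unit over the integers.
\<close>

lemma fps_cong_cancel:
  assumes "fps_cong m (F * U) (G * U)" "U $ 0 = 1"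
  shows "fps_cong m F G"
proof -
  obtain V where V: "U * V = 1"
    using fps_is_left_unit_iff_zeroth_is_left_unit[of U] assms(2) by auto
  have "fps_cong m (F * U * V) (G * U * V)"
    by (rule fps_cong_mult[OF assms(1)]) simp
  then show ?thesis by (simp add: mult.assoc V)
qed

text \<open>
  The Frobenius congruence \<open>F(q)^3 \<equiv> F(q^3)\<close>.  Splitting off the constant term, \<open>F = c + q T\<close>, the two mixed
  terms of the cube are divisible by 3 and \<open>c^3 \<equiv> c\<close>, so the coefficients of \<open>F^3\<close> reduce to earlier
  coefficients of \<open>T^3\<close>.
\<close>

lemma fps_cong_cube: "fps_cong 3 (F ^ 3) (dilate 3 F)"
proof -
  have "[(F ^ 3) $ n = dilate 3 F $ n] (mod 3)" for n
  proof (induction n arbitrary: F rule: less_induct)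
    case (less n)
    define c where "c = fps_const (F $ 0)"
    define T where "T = fps_shift 1 F"
    have F: "F = c + fps_X * T"
      unfolding c_def T_def by (rule fps_ext) (simp add: fps_X_mult_nth)
    have c3: "[(F $ 0) ^ 3 = F $ 0] (mod 3)"
    proof -
      have "(F $ 0) ^ 3 - F $ 0 = (F $ 0 - 1) * F $ 0 * (F $ 0 + 1)"
        by (simp add: power3_eq_cube algebra_simps)
      moreover have "3 dvd (F $ 0 - 1) * F $ 0 * (F $ 0 + 1)"
      proof -
        have "F $ 0 mod 3 = 0 \<or> F $ 0 mod 3 = 1 \<or> F $ 0 mod 3 = 2" by presburger
        then have "3 dvd F $ 0 - 1 \<or> 3 dvd F $ 0 \<or> 3 dvd F $ 0 + 1" by presburger
        then show ?thesis by auto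
      qed
      ultimately show ?thesis by (simp add: cong_iff_dvd_diff)
    qed
    have "F ^ 3 - (c ^ 3 + fps_X ^ 3 * T ^ 3) = 3 * (c ^ 2 * fps_X * T + c * fps_X ^ 2 * T ^ 2)"
      unfolding F by (simp add: power3_eq_cube power2_eq_square algebra_simps)
    then have "fps_cong 3 (F ^ 3) (c ^ 3 + fps_X ^ 3 * T ^ 3)"
      by (simp add: fps_cong_3)
    then have 1: "[(F ^ 3) $ n = (c ^ 3 + fps_X ^ 3 * T ^ 3) $ n] (mod 3)"
      by (simp add: fps_cong_def)
    have 2: "(c ^ 3 + fps_X ^ 3 * T ^ 3) $ n
        = (if n = 0 then (F $ 0) ^ 3 else 0) + (if n < 3 then 0 else (T ^ 3) $ (n - 3))"
      by (simp add: c_def fps_const_power fps_X_power_mult_nth)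
    have 3: "dilate 3 F $ n
        = (if n = 0 then F $ 0 else 0) + (if n < 3 then 0 else dilate 3 T $ (n - 3))"
    proof -
      have "dilate 3 F = c + fps_X ^ 3 * dilate 3 T"
        by (subst F) (simp add: c_def dilate_def fps_compose_add_distrib fps_compose_mult_distrib)
      then show ?thesis by (simp add: c_def fps_X_power_mult_nth)
    qed
    have "[(T ^ 3) $ (n - 3) = dilate 3 T $ (n - 3)] (mod 3)" if "\<not> n < 3"
      using less that by simp
    then show ?case
      using 1 c3 unfolding 2 3 by (auto intro: cong_trans cong_add split: if_splits)
  qed
  then show ?thesis by (simp add: fps_cong_def)
qed

section \<open>Generating functions of overpartitions\<close>

text \<open>
  Once the part sizes are given, the overlined ones form an arbitrary subset, so a partition with \<open>d\<close>
  distinct part sizes carries \<open>2^d\<close> overpartitions.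
\<close>

definition partitions_in :: "nat set \<Rightarrow> nat \<Rightarrow> nat list set" where
  "partitions_in A n = {ps. sorted_wrt (\<ge>) ps \<and> set ps \<subseteq> A \<and> sum_list ps = n}"

definition overpartition_gf :: "nat set \<Rightarrow> int fps" where
  "overpartition_gf A = Abs_fps (\<lambda>n. \<Sum>ps\<in>partitions_in A n. 2 ^ card (set ps))"

lemma finite_partitions_in:
  assumes "0 \<notin> A"
  shows "finite (partitions_in A n)"
proof -
  have "ps \<in> fst ` overpartitions n" if "ps \<in> partitions_in A n" for ps
  proof
    show "(ps, {}) \<in> overpartitions n"
      using that assms by (auto simp: partitions_in_def overpartitions_def intro!: gr0I)
  qed simp
  then show ?thesis
    by (meson finite_overpartitions finite_imageI finite_subset subsetI)
qed

lemma Rbar_eq_overpartition_gf: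
  "int (Rbar l m n) = overpartition_gf {p. 0 < p \<and> \<not> l dvd p \<and> \<not> m dvd p} $ n"
proof -
  let ?A = "{p. 0 < p \<and> \<not> l dvd p \<and> \<not> m dvd p}"
  have "overpartitions_regular l m n = Sigma (partitions_in ?A n) (\<lambda>ps. Pow (set ps))"
    by (auto simp: overpartitions_regular_def overpartitions_def partitions_in_def)
  then show ?thesis
    by (simp add: Rbar_def overpartition_gf_def card_SigmaI finite_partitions_in card_Pow)
qed

lemma overpartition_gf_nth_cong:
  assumes "A \<inter> {..n} = B \<inter> {..n}"
  shows "overpartition_gf A $ n = overpartition_gf B $ n"
proof -
  have "set ps \<subseteq> {..n}" if "sum_list ps = n" for ps :: "nat list"
    using that member_le_sum_list by fastforce
  then have "partitions_in A n = partitions_in B n"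
    using assms unfolding partitions_in_def by blast
  then show ?thesis by (simp add: overpartition_gf_def)
qed

lemma overpartition_gf_empty [simp]: "overpartition_gf {} = 1"
proof (rule fps_ext)
  fix n
  have "partitions_in {} n = (if n = 0 then {[]} else {})"
    by (auto simp: partitions_in_def)
  then show "overpartition_gf {} $ n = 1 $ n" by (simp add: overpartition_gf_def)
qed

text \<open>
  If the largest admissible part \<open>a\<close> occurs, remove one copy of it.  The remaining partition either still
  contains \<open>a\<close>, and then the number of overlinings is unchanged, or it has no part \<open>a\<close> at all and the number
  of overlinings is halved.  This gives \<open>O' = O + q^a (O' + O)\<close> for the series before and after admitting
  \<open>a\<close>, that is, the Euler factor \<open>(1 + q^a) / (1 - q^a)\<close> in a form without division.
\<close>

lemma overpartition_gf_insert:
  assumes A: "0 \<notin> A" and a: "\<And>b. b \<in> A \<Longrightarrow> b < a" "a > 0"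
  shows "(1 - fps_X ^ a) * overpartition_gf (insert a A) = (1 + fps_X ^ a) * overpartition_gf A"
proof -
  let ?f = "\<lambda>ps. 2 ^ card (set ps) :: int" and ?B = "insert a A"
  have aA: "a \<notin> A" using a(1) by blast
  have B: "0 \<notin> ?B" using A a(2) by auto
  have split: "partitions_in ?B n
      = partitions_in A n \<union> (if a \<le> n then (#) a ` partitions_in ?B (n - a) else {})" for n
  proof (intro equalityI subsetI)
    fix ps assume ps: "ps \<in> partitions_in ?B n"
    show "ps \<in> partitions_in A n \<union> (if a \<le> n then (#) a ` partitions_in ?B (n - a) else {})"
    proof (cases "a \<in> set ps")
      case False
      then show ?thesis using ps by (auto simp: partitions_in_def)
    next
      case True
      then obtain b qs where q: "ps = b # qs" by (cases ps) auto
      have "b \<ge> a" using True ps by (auto simp: q partitions_in_def)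
      moreover have "b \<le> a" using ps a(1) by (force simp: q partitions_in_def)
      ultimately have "b = a" by simp
      then show ?thesis using ps by (auto simp: q partitions_in_def)
    qed
  next
    fix ps assume "ps \<in> partitions_in A n \<union> (if a \<le> n then (#) a ` partitions_in ?B (n - a) else {})"
    moreover have "sorted_wrt (\<ge>) (a # qs)" if "qs \<in> partitions_in ?B m" for qs m
      using that a(1) by (fastforce simp: partitions_in_def)
    ultimately show "ps \<in> partitions_in ?B n"
      by (auto simp: partitions_in_def split: if_splits)
  qed
  have cons: "(\<Sum>ps\<in>(#) a ` partitions_in ?B m. ?f ps)
      = (overpartition_gf ?B + overpartition_gf A) $ m" for m
  proof -
    have "(\<Sum>ps\<in>(#) a ` partitions_in ?B m. ?f ps) = (\<Sum>qs\<in>partitions_in ?B m. ?f (a # qs))"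
      by (subst sum.reindex) (auto simp: inj_on_def)
    also have "\<dots> = (\<Sum>qs\<in>partitions_in ?B m. ?f qs + (if a \<in> set qs then 0 else ?f qs))"
      by (intro sum.cong) (auto simp: insert_absorb)
    also have "\<dots> = (\<Sum>qs\<in>partitions_in ?B m. ?f qs)
        + (\<Sum>qs\<in>{qs \<in> partitions_in ?B m. a \<notin> set qs}. ?f qs)"
      unfolding sum.inter_filter[OF finite_partitions_in[OF B]] sum.distrib[symmetric]
      by (rule sum.cong) auto
    also have "{qs \<in> partitions_in ?B m. a \<notin> set qs} = partitions_in A m"
      using aA by (auto simp: partitions_in_def)
    finally show ?thesis by (simp add: overpartition_gf_def)
  qed
  have "overpartition_gf ?B = overpartition_gf A + fps_X ^ a * (overpartition_gf ?B + overpartition_gf A)"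
  proof (rule fps_ext)
    fix n
    let ?C = "if a \<le> n then (#) a ` partitions_in ?B (n - a) else {}"
    have "a \<in> set ps" if "ps \<in> ?C" for ps
      using that by (auto split: if_splits)
    moreover have "a \<notin> set ps" if "ps \<in> partitions_in A n" for ps
      using that aA unfolding partitions_in_def by blast
    ultimately have disj: "partitions_in A n \<inter> ?C = {}"
      by blast
    have fin: "finite (partitions_in A n)" "finite ?C"
      using finite_partitions_in[OF A] finite_partitions_in[OF B] by simp_all
    have "overpartition_gf ?B $ n = sum ?f (partitions_in A n \<union> ?C)"
      unfolding overpartition_gf_def fps_nth_Abs_fps by (rule sum.cong[OF split]) simp
    also have "\<dots> = (\<Sum>ps\<in>partitions_in A n. ?f ps)
        + (\<Sum>ps\<in>(if a \<le> n then (#) a ` partitions_in ?B (n - a) else {}). ?f ps)"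
      by (rule sum.union_disjoint[OF fin disj])
    also have "\<dots> = (overpartition_gf A
        + fps_X ^ a * (overpartition_gf ?B + overpartition_gf A)) $ n"
      using cons by (simp add: fps_X_power_mult_nth overpartition_gf_def)
    finally show "overpartition_gf ?B $ n = (overpartition_gf A
        + fps_X ^ a * (overpartition_gf ?B + overpartition_gf A)) $ n" .
  qed
  moreover have "F = G + x * (F + G) \<Longrightarrow> (1 - x) * F = (1 + x) * G" for F G x :: "int fps"
    by algebra
  ultimately show ?thesis by blast
qed

lemma overpartition_gf_product:
  assumes "finite A" "0 \<notin> A"
  shows "(\<Prod>a\<in>A. 1 - fps_X ^ a) * overpartition_gf A = (\<Prod>a\<in>A. 1 + fps_X ^ a)"
  using assms
proof (induction A rule: finite_linorder_max_induct)
  case (insert a A)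
  have aA: "a \<notin> A" using insert.hyps by blast
  have "(\<Prod>b\<in>insert a A. 1 - fps_X ^ b) * overpartition_gf (insert a A)
      = (\<Prod>b\<in>A. 1 - fps_X ^ b) * ((1 - fps_X ^ a) * overpartition_gf (insert a A))"
    using insert.hyps aA by (simp add: ac_simps)
  also have "(1 - fps_X ^ a) * overpartition_gf (insert a A) = (1 + fps_X ^ a) * overpartition_gf A"
    using insert by (intro overpartition_gf_insert) auto
  finally have "(\<Prod>b\<in>insert a A. 1 - fps_X ^ b) * overpartition_gf (insert a A)
      = (1 + fps_X ^ a) * ((\<Prod>b\<in>A. 1 - fps_X ^ b) * overpartition_gf A)"
    by (simp only: ac_simps)
  also have "(\<Prod>b\<in>A. 1 - fps_X ^ b) * overpartition_gf A = (\<Prod>b\<in>A. 1 + fps_X ^ b)"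
    using insert by simp
  finally show ?case using insert.hyps(1) aA by simp
qed simp

lemma prod_one_minus_X_power_nonzero:
  assumes "finite A" "0 \<notin> A"
  shows "(\<Prod>a\<in>A. 1 - fps_X ^ a :: int fps) \<noteq> 0"
proof -
  have "(1 - fps_X ^ a :: int fps) $ 0 \<noteq> 0" if "a \<noteq> 0" for a
    using that by simp
  then have "1 - fps_X ^ a \<noteq> (0 :: int fps)" if "a \<noteq> 0" for a
    using that by (metis fps_zero_nth)
  then show ?thesis using assms by (subst prod_zero_iff) metis+
qed

lemma overpartition_gf_eqI:
  assumes "finite A" "0 \<notin> A" "(\<Prod>a\<in>A. 1 - fps_X ^ a) * F = (\<Prod>a\<in>A. 1 + fps_X ^ a)"
  shows "F = overpartition_gf A"
proof -
  have "(\<Prod>a\<in>A. 1 - fps_X ^ a) * F = (\<Prod>a\<in>A. 1 - fps_X ^ a) * overpartition_gf A"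
    by (simp only: assms(3) overpartition_gf_product[OF assms(1,2)])
  then show ?thesis
    using prod_one_minus_X_power_nonzero[OF assms(1,2)] by (simp only: mult_cancel_left) simp
qed

text \<open>
  The product formulas hold for finite sets of part sizes; a coefficient of index \<open>n\<close> only depends on
  the part sizes up to \<open>n\<close>, which extends them to infinite sets.
\<close>

lemma overpartition_gf_Un:
  assumes "0 \<notin> A" "0 \<notin> B" "A \<inter> B = {}"
  shows "overpartition_gf (A \<union> B) = overpartition_gf A * overpartition_gf B"
proof (rule fps_ext)
  fix n
  define A' B' where "A' = A \<inter> {..n}" and "B' = B \<inter> {..n}"
  have fin: "finite A'" "finite B'" by (simp_all add: A'_def B'_def)
  have 0: "0 \<notin> A'" "0 \<notin> B'" "A' \<inter> B' = {}" using assms by (auto simp: A'_def B'_def)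
  have "overpartition_gf A' * overpartition_gf B' = overpartition_gf (A' \<union> B')"
  proof (rule overpartition_gf_eqI)
    have "(\<Prod>a\<in>A' \<union> B'. 1 - fps_X ^ a) * (overpartition_gf A' * overpartition_gf B')
        = ((\<Prod>a\<in>A'. 1 - fps_X ^ a) * overpartition_gf A') * ((\<Prod>a\<in>B'. 1 - fps_X ^ a) * overpartition_gf B')"
      unfolding prod.union_disjoint[OF fin 0(3)] by (simp only: ac_simps)
    then show "(\<Prod>a\<in>A' \<union> B'. 1 - fps_X ^ a) * (overpartition_gf A' * overpartition_gf B')
        = (\<Prod>a\<in>A' \<union> B'. 1 + fps_X ^ a)"
      by (simp only: overpartition_gf_product[OF fin(1) 0(1)] overpartition_gf_product[OF fin(2) 0(2)]
          prod.union_disjoint[OF fin 0(3)])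
  qed (use fin 0 in auto)
  moreover have "overpartition_gf (A \<union> B) $ n = overpartition_gf (A' \<union> B') $ n"
    by (rule overpartition_gf_nth_cong) (auto simp: A'_def B'_def)
  moreover have "overpartition_gf A $ i = overpartition_gf A' $ i"
      "overpartition_gf B $ i = overpartition_gf B' $ i" if "i \<le> n" for i
    using that by (auto simp: A'_def B'_def intro!: overpartition_gf_nth_cong)
  then have "(overpartition_gf A * overpartition_gf B) $ n
      = (overpartition_gf A' * overpartition_gf B') $ n"
    by (simp add: fps_mult_nth)
  ultimately show "overpartition_gf (A \<union> B) $ n = (overpartition_gf A * overpartition_gf B) $ n"
    by simp
qed

lemma overpartition_gf_dilate:
  assumes k: "k > 0" and A: "0 \<notin> A"
  shows "overpartition_gf ((\<lambda>a. k * a) ` A) = dilate k (overpartition_gf A)"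
proof (rule fps_ext)
  fix n
  define A' where "A' = A \<inter> {..n}"
  have fin: "finite A'" and 0: "0 \<notin> A'" using A by (auto simp: A'_def)
  have inj: "inj_on (\<lambda>a. k * a) A'" using k by (auto simp: inj_on_def)
  have "dilate k ((\<Prod>a\<in>A'. 1 - fps_X ^ a) * overpartition_gf A') = dilate k (\<Prod>a\<in>A'. 1 + fps_X ^ a)"
    by (simp only: overpartition_gf_product[OF fin 0])
  then have "dilate k (overpartition_gf A') = overpartition_gf ((\<lambda>a. k * a) ` A')"
    using k fin 0 inj
    by (intro overpartition_gf_eqI) (auto simp: dilate_prod prod.reindex power_mult)
  moreover have "overpartition_gf ((\<lambda>a. k * a) ` A) $ n = overpartition_gf ((\<lambda>a. k * a) ` A') $ n"
  proof (rule overpartition_gf_nth_cong)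
    have "a \<le> n" if "k * a \<le> n" for a
      using that k by (cases k) auto
    then show "(\<lambda>a. k * a) ` A \<inter> {..n} = (\<lambda>a. k * a) ` A' \<inter> {..n}" by (auto simp: A'_def)
  qed
  moreover have "overpartition_gf A $ (n div k) = overpartition_gf A' $ (n div k)"
    by (rule overpartition_gf_nth_cong)
      (use div_le_dividend[of n k] in \<open>auto simp: A'_def intro: order_trans\<close>)
  ultimately show "overpartition_gf ((\<lambda>a. k * a) ` A) $ n = dilate k (overpartition_gf A) $ n"
    using k by (metis dilate_nth)
qed

abbreviation all_overpartitions_gf :: "int fps" where
  "all_overpartitions_gf \<equiv> overpartition_gf {0<..}"

text \<open>
  The generating function in product form: the positive integers split into those divisible by neither
  \<open>l\<close> nor \<open>m\<close>, the multiples of \<open>l\<close>, and the multiples of \<open>m\<close> but not \<open>l\<close>; the latter together with the multiples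
  of \<open>l m\<close> make up the multiples of \<open>m\<close>.
\<close>

lemma Rbar_gf_mult:
  assumes "coprime l m" "l > 0" "m > 0"
  shows "Abs_fps (\<lambda>n. int (Rbar l m n)) * dilate l all_overpartitions_gf * dilate m all_overpartitions_gf
    = all_overpartitions_gf * dilate (l * m) all_overpartitions_gf"
proof -
  let ?M = "\<lambda>k. (\<lambda>a. k * a) ` {0<..} :: nat set"
  let ?R = "{p. 0 < p \<and> \<not> l dvd p \<and> \<not> m dvd p}"
  have mult: "?M k = {p. 0 < p \<and> k dvd p}" if "k > 0" for k
    using that by (auto simp: image_def dvd_def)
  have M: "dilate k all_overpartitions_gf = overpartition_gf {p. 0 < p \<and> k dvd p}" if "k > 0" for k
    using overpartition_gf_dilate[OF that, of "{0<..}"] mult[OF that] by simp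
  have lm: "l * m dvd p \<longleftrightarrow> l dvd p \<and> m dvd p" for p
    using assms(1) divides_mult by (auto intro: dvd_mult_left dvd_mult_right)
  let ?L = "{p. 0 < p \<and> l dvd p}" and ?M' = "{p. 0 < p \<and> m dvd p}" and ?LM = "{p. 0 < p \<and> l * m dvd p}"
  let ?D = "{p. 0 < p \<and> m dvd p \<and> \<not> l dvd p}"
  have R: "Abs_fps (\<lambda>n. int (Rbar l m n)) = overpartition_gf ?R"
    by (simp add: fps_eq_iff Rbar_eq_overpartition_gf)
  have "{0<..} = ?R \<union> (?L \<union> ?D)" by auto
  then have 1: "all_overpartitions_gf = overpartition_gf ?R * (overpartition_gf ?L * overpartition_gf ?D)"
    using overpartition_gf_Un[of ?R "?L \<union> ?D"] overpartition_gf_Un[of ?L ?D] by fastforce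
  have "?M' = ?LM \<union> ?D" by (auto simp: lm)
  moreover have "?LM \<inter> ?D = {}" by (auto simp: lm)
  ultimately have 2: "overpartition_gf ?M' = overpartition_gf ?LM * overpartition_gf ?D"
    using overpartition_gf_Un[of ?LM ?D] by simp
  have "l * m > 0" using assms by simp
  then show ?thesis
    unfolding R M[OF assms(2)] M[OF assms(3)] M[OF \<open>l * m > 0\<close>]
    unfolding 1 2 by (simp only: ac_simps)
qed

section \<open>Gauss's theta series as the inverse of the overpartition series\<close>

definition parity_sign :: "int \<Rightarrow> int" where
  "parity_sign x = (if even x then 1 else - 1)"

text \<open>
  The general shape \<open>\<Sum>x\<in>A. w(x) q^e(x)\<close>.  Exponents are integer-valued so that quadratic forms in several
  integer variables can be substituted freely; only \<open>x\<close> with \<open>e(x) \<ge> 0\<close> contribute.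
\<close>

definition theta_series :: "'a set \<Rightarrow> ('a \<Rightarrow> int) \<Rightarrow> ('a \<Rightarrow> int) \<Rightarrow> int fps" where
  "theta_series A e w = Abs_fps (\<lambda>n. \<Sum>x | x \<in> A \<and> e x = int n. w x)"

text \<open>
  This is Ramanujan's \<open>\<phi>(-q) = 1 - 2q + 2q^4 - 2q^9 + ...\<close>.
\<close>

definition theta :: "int fps" where
  "theta = theta_series UNIV (\<lambda>x. x\<^sup>2) parity_sign"

definition gauss_partial_sum :: "nat \<Rightarrow> int fps" where
  "gauss_partial_sum n = 1 + 2 * (\<Sum>k=1..n. (-1) ^ k * fps_X ^ (k\<^sup>2))"

text \<open>
  A finite form of Gauss's identity \<open>\<phi>(-q) = \<Prod>(1 - q^n) / (1 + q^n)\<close>, in the style of Shanks.  Let \<open>O_s\<close> be the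
  series of overpartitions with parts at most \<open>s\<close>.  Passing from \<open>n - 1\<close> to \<open>n\<close> and clearing the factor
  \<open>1 - q^n\<close>, the difference of the two sums on the right becomes an alternating sum of
  \<open>u_s + u_(s+1)\<close> with \<open>u_s = 2 O_s q^((s+1) n)\<close>, which telescopes.  One end makes up for the change of
  the factor \<open>1 + q^n\<close> of the leading 1 into \<open>1 - q^n\<close>; the other turns the new term \<open>2 (-1)^n q^(n^2)\<close> of the
  partial sum into the last summand on the right.
\<close>

lemma gauss_partial_sum_overpartition_gf:
  fixes n :: nat
  defines "Ov \<equiv> \<lambda>n. overpartition_gf {1..n}"
  shows "gauss_partial_sum n * Ov n = 1 + (\<Sum>s=1..n. (-1) ^ s * (Ov s + Ov (s - 1)) * fps_X ^ (s * (n + 1)))"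
proof (induction n)
  case 0
  then show ?case by (simp add: gauss_partial_sum_def Ov_def)
next
  case (Suc m)
  define n where "n = Suc m"
  define q where "q = (fps_X :: int fps)"
  let ?W = "\<lambda>s. Ov s + Ov (s - 1)"
  have rec: "(1 - q ^ Suc s) * Ov (Suc s) = (1 + q ^ Suc s) * Ov s" for s
    using overpartition_gf_insert[of "{1..s}" "Suc s"]
    by (simp add: Ov_def q_def atLeastAtMostSuc_conv)
  \<comment> \<open>The weight \<open>O_s + O_(s-1)\<close> equals \<open>2 O_s / (1 + q^s) = 2 O_(s-1) / (1 - q^s)\<close>.\<close>
  have W1: "(1 - q ^ Suc s) * ?W (Suc s) = 2 * Ov s" for s
    using rec[of s] by (simp add: algebra_simps)
  have W2: "(1 + q ^ Suc s) * ?W (Suc s) = 2 * Ov (Suc s)" for s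
    using rec[of s] by (simp add: algebra_simps)
  define u where "u = (\<lambda>s. 2 * Ov s * q ^ (Suc s * n))"
  have step: "?W (Suc s) * (1 + q ^ n) * q ^ (Suc s * n) - ?W (Suc s) * (1 - q ^ n) * q ^ (Suc s * (n + 1))
      = u s + u (Suc s)" for s
  proof -
    have "q ^ (Suc s * (n + 1)) = q ^ (Suc s * n) * q ^ Suc s"
      by (simp add: algebra_simps flip: power_add)
    moreover have "q ^ (Suc (Suc s) * n) = q ^ (Suc s * n) * q ^ n"
      by (simp add: algebra_simps flip: power_add)
    moreover have "?W (Suc s) * (1 + q ^ n) * Q - ?W (Suc s) * (1 - q ^ n) * (Q * q ^ Suc s)
      = Q * ((1 - q ^ Suc s) * ?W (Suc s)) + Q * q ^ n * ((1 + q ^ Suc s) * ?W (Suc s))" for Q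
      by algebra
    ultimately show ?thesis unfolding u_def by (simp only: W1 W2) (simp add: algebra_simps)
  qed
  have tele: "(\<Sum>s<k. (-1) ^ s * (u s + u (Suc s))) = u 0 - (-1) ^ k * u k" for k
    by (induction k) (simp_all add: algebra_simps)
  have shift: "(\<Sum>s=1..k. f s) = (\<Sum>s<k. f (Suc s))" for f :: "nat \<Rightarrow> int fps" and k
    by (simp add: sum.atLeast1_atMost_eq)
  let ?T = "\<lambda>k e. \<Sum>s<k. (-1) ^ Suc s * ?W (Suc s) * q ^ (Suc s * e)"
  have IH: "gauss_partial_sum m * Ov m = 1 + ?T m n"
    using Suc.IH unfolding shift by (simp only: n_def q_def diff_Suc_1 Suc_eq_plus1)
  have S: "gauss_partial_sum n = gauss_partial_sum m + 2 * (-1) ^ n * q ^ (n * n)"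
    by (simp add: gauss_partial_sum_def n_def q_def power2_eq_square algebra_simps)
  have "(1 - q ^ n) * (gauss_partial_sum n * Ov n) = gauss_partial_sum n * ((1 - q ^ n) * Ov n)"
    by (simp add: ac_simps)
  also have "(1 - q ^ n) * Ov n = (1 + q ^ n) * Ov m"
    using rec[of m] by (simp add: n_def)
  also have "gauss_partial_sum n * ((1 + q ^ n) * Ov m)
      = (1 + q ^ n) * (1 + ?T m n) + (1 + q ^ n) * 2 * (-1) ^ n * q ^ (n * n) * Ov m"
    unfolding S by (simp only: IH[symmetric]) (simp add: algebra_simps)
  also have "\<dots> = (1 - q ^ n) * (1 + ?T n (n + 1))"
  proof -
    have "(1 + q ^ n) * ?T m n - (1 - q ^ n) * ?T m (n + 1)
       = - (\<Sum>s<m. (-1) ^ s * (u s + u (Suc s)))"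
      unfolding step[symmetric] sum_distrib_left sum_subtractf[symmetric] sum_negf[symmetric]
      by (intro sum.cong) (simp_all add: algebra_simps)
    then have 1: "(1 + q ^ n) * ?T m n = (1 - q ^ n) * ?T m (n + 1) - u 0 + (-1) ^ m * u m"
      unfolding tele by (simp add: algebra_simps)
    have 2: "?T n (n + 1) = ?T m (n + 1) + (-1) ^ n * ?W n * q ^ (n * (n + 1))"
      by (simp add: n_def)
    have 3: "(1 - q ^ n) * ?W n = 2 * Ov m"
      using W1[of m] by (simp add: n_def)
    have 4: "q ^ (n * (n + 1)) = q ^ (n * n) * q ^ n"
      by (simp add: power_add)
    have 5: "u 0 = 2 * q ^ n" "u m = 2 * Ov m * q ^ (n * n)" "(-1) ^ n = - ((-1) ^ m :: int fps)"
      by (simp_all add: u_def n_def Ov_def)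
    have "(1 + Q) * (1 + T1) + (1 + Q) * 2 * - c * R * F = (1 - Q) * (1 + T3)"
      if "(1 + Q) * T1 = (1 - Q) * T2 - 2 * Q + c * (2 * F * R)"
        "T3 = T2 + - c * W * (R * Q)" "(1 - Q) * W = 2 * F"
      for Q T1 T2 T3 c F R W :: "int fps"
      using that by algebra
    from this[OF 1[unfolded 5(1,2)] 2[unfolded 4 5(3)] 3] show ?thesis
      by (simp only: 5(3))
  qed
  finally have "(1 - q ^ n) * (gauss_partial_sum n * Ov n) = (1 - q ^ n) * (1 + ?T n (n + 1))" .
  moreover have "1 - q ^ n \<noteq> 0"
    using prod_one_minus_X_power_nonzero[of "{n}"] by (simp add: q_def n_def)
  ultimately have "gauss_partial_sum n * Ov n = 1 + ?T n (n + 1)"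
    by simp
  then show ?case unfolding shift by (simp only: n_def q_def diff_Suc_1)
qed

lemma theta_nth_eq_gauss_partial_sum:
  assumes "i \<le> n"
  shows "theta $ i = gauss_partial_sum n $ i"
proof -
  have nth: "gauss_partial_sum n $ i = (if i = 0 then 1 else 0)
      + 2 * (\<Sum>k\<in>{1..n}. if k\<^sup>2 = i then (-1) ^ k else 0)"
  proof -
    have c: "(-1) ^ k = fps_const ((-1 :: int) ^ k)" for k
      by (metis fps_const_1_eq_1 fps_const_neg fps_const_power)
    have "((-1) ^ k * fps_X ^ (k\<^sup>2) :: int fps) $ i = (if k\<^sup>2 = i then (-1) ^ k else 0)" for k
      unfolding c by auto
    then show ?thesis
      by (simp add: gauss_partial_sum_def numeral_fps_const fps_sum_nth)
  qed
  show ?thesis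
  proof (cases "\<exists>j. i = j\<^sup>2")
    case True
    then obtain j where j: "i = j\<^sup>2" ..
    have set: "{x. x \<in> UNIV \<and> x\<^sup>2 = int i} = {int j, - int j}"
      using j power2_eq_iff[of _ "int j"] by auto
    show ?thesis
    proof (cases "j = 0")
      case True
      then show ?thesis
        unfolding nth theta_def theta_series_def fps_nth_Abs_fps set
        by (simp add: j parity_sign_def)
    next
      case False
      have "j \<le> n" using assms j self_le_power[of j 2] False by linarith
      then have "{k \<in> {1..n}. k\<^sup>2 = i} = {j}" using False j by auto
      then have "(\<Sum>k\<in>{1..n}. if k\<^sup>2 = i then (-1) ^ k else 0) = ((-1) ^ j :: int)"
        by (simp flip: sum.inter_filter)
      moreover have "(-1) ^ j = parity_sign (int j)" by (simp add: parity_sign_def)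
      ultimately show ?thesis
        using False unfolding nth theta_def theta_series_def fps_nth_Abs_fps set
        by (simp add: j parity_sign_def)
    qed
  next
    case False
    have "{x. x \<in> UNIV \<and> x\<^sup>2 = int i} = {}"
    proof safe
      fix x :: int assume "x\<^sup>2 = int i"
      then have "i = (nat \<bar>x\<bar>)\<^sup>2" by (simp flip: nat_power_eq)
      then show "x \<in> {}" using False by blast
    qed
    moreover have "(\<Sum>k\<in>{1..n}. if k\<^sup>2 = i then (-1) ^ k else 0) = (0 :: int)"
      using False by (intro sum.neutral) auto
    moreover have "i \<noteq> 0" using False by (metis zero_power2)
    ultimately show ?thesis
      unfolding nth theta_def theta_series_def fps_nth_Abs_fps by simp
  qed
qed

text \<open>
  Every summand on the right of the finite identity has order at least \<open>n + 1\<close>, so coefficient \<open>n\<close> of the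
  product agrees with that of 1.
\<close>

lemma theta_mult_overpartitions: "theta * all_overpartitions_gf = 1"
proof (rule fps_ext)
  fix n
  have O: "all_overpartitions_gf $ i = overpartition_gf {1..n} $ i" if "i \<le> n" for i
    using that by (intro overpartition_gf_nth_cong) auto
  have "(theta * all_overpartitions_gf) $ n = (gauss_partial_sum n * overpartition_gf {1..n}) $ n"
    unfolding fps_mult_nth
    by (intro sum.cong) (auto simp: O theta_nth_eq_gauss_partial_sum)
  also have "\<dots> = 1 $ n"
  proof -
    have "((-1) ^ s * (overpartition_gf {1..s} + overpartition_gf {1..s - 1}) * fps_X ^ (s * (n + 1))) $ n = 0"
      if "s \<in> {1..n}" for s
    proof -
      have "n < s * (n + 1)" using that by (cases s) auto
      then show ?thesis by (simp only: fps_X_power_mult_right_nth if_True)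
    qed
    then show ?thesis
      unfolding gauss_partial_sum_overpartition_gf by (simp only: fps_add_nth fps_sum_nth) simp
  qed
  finally show "(theta * all_overpartitions_gf) $ n = 1 $ n" .
qed

text \<open>
  The starting point of all congruences below: \<open>G = \<phi>(-q^l) \<phi>(-q^m) / (\<phi>(-q) \<phi>(-q^(l m)))\<close> for the generating
  function \<open>G\<close> of \<open>Rbar l m\<close>.
\<close>

lemma Rbar_gf_theta:
  assumes "coprime l m" "l > 0" "m > 0"
  shows "Abs_fps (\<lambda>n. int (Rbar l m n)) * theta * dilate (l * m) theta = dilate l theta * dilate m theta"
proof -
  let ?O = all_overpartitions_gf and ?G = "Abs_fps (\<lambda>n. int (Rbar l m n))"
  have inv: "dilate k theta * dilate k ?O = 1" if "k > 0" for k
    using arg_cong[OF theta_mult_overpartitions, of "dilate k"] that by simp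
  have "l * m > 0" using assms by simp
  note invs = inv[OF assms(2)] inv[OF assms(3)] inv[OF this] theta_mult_overpartitions
  have "?G * theta * dilate (l * m) theta
      = (?G * dilate l ?O * dilate m ?O) * theta * dilate (l * m) theta * (dilate l theta * dilate m theta)"
    using invs(1,2) by algebra
  also have "\<dots> = dilate l theta * dilate m theta"
    unfolding Rbar_gf_mult[OF assms] using invs(3,4) by algebra
  finally show ?thesis .
qed

section \<open>Manipulating theta series\<close>

text \<open>
  The coefficient of \<open>q^n\<close> is a sum over a fibre of the exponent; on an infinite fibre the sum would
  silently be 0, so additivity and products need finite fibres.
\<close>

definition finite_fibres :: "'a set \<Rightarrow> ('a \<Rightarrow> int) \<Rightarrow> bool" where
  "finite_fibres A e \<longleftrightarrow> (\<forall>n. finite {x. x \<in> A \<and> e x = n})"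

lemma finite_fibres_subset: "finite_fibres B e \<Longrightarrow> A \<subseteq> B \<Longrightarrow> finite_fibres A e"
  unfolding finite_fibres_def by (auto intro: finite_subset[rotated])

lemma finite_fibres_int:
  assumes "\<And>x. x \<in> A \<Longrightarrow> \<bar>x\<bar> \<le> e x + c"
  shows "finite_fibres A e"
  unfolding finite_fibres_def
proof
  fix n
  have "{x. x \<in> A \<and> e x = n} \<subseteq> {-(n + c)..n + c}"
    using assms by force
  then show "finite {x. x \<in> A \<and> e x = n}" by (rule finite_subset) simp
qed

lemma abs_le_square_int: "\<bar>x :: int\<bar> \<le> x\<^sup>2"
  using self_le_power[of "\<bar>x\<bar>" 2] by (cases "x = 0") auto

lemma finite_fibres_int_pair:
  assumes "\<And>x y. (x, y) \<in> A \<Longrightarrow> x\<^sup>2 + y\<^sup>2 \<le> m * e (x, y) + c"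
  shows "finite_fibres A e"
  unfolding finite_fibres_def
proof
  fix n
  have "(x, y) \<in> {-(m * n + c)..m * n + c} \<times> {-(m * n + c)..m * n + c}"
    if "(x, y) \<in> A" "e (x, y) = n" for x y
    using assms[OF that(1)] that(2) abs_le_square_int[of x] abs_le_square_int[of y] by simp linarith
  then have "{x. x \<in> A \<and> e x = n} \<subseteq> {-(m * n + c)..m * n + c} \<times> {-(m * n + c)..m * n + c}"
    by auto
  then show "finite {x. x \<in> A \<and> e x = n}" by (rule finite_subset) simp
qed

lemma theta_series_mult:
  assumes A: "finite_fibres A e" "\<And>x. x \<in> A \<Longrightarrow> 0 \<le> e x"
    and B: "finite_fibres B f" "\<And>y. y \<in> B \<Longrightarrow> 0 \<le> f y"
  shows "theta_series A e w * theta_series B f v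
    = theta_series (A \<times> B) (\<lambda>(x, y). e x + f y) (\<lambda>(x, y). w x * v y)"
proof (rule fps_ext)
  fix n
  let ?FA = "\<lambda>i. {x. x \<in> A \<and> e x = i}" and ?FB = "\<lambda>i. {y. y \<in> B \<and> f y = i}"
  let ?S = "\<lambda>i. ?FA (int i) \<times> ?FB (int (n - i))"
  have fin: "finite (?FA i)" "finite (?FB i)" for i
    using A(1) B(1) by (simp_all add: finite_fibres_def)
  have un: "{p. p \<in> A \<times> B \<and> (case p of (x, y) \<Rightarrow> e x + f y) = int n} = (\<Union>i\<in>{0..n}. ?S i)"
  proof (intro equalityI subsetI)
    fix p assume p: "p \<in> {p. p \<in> A \<times> B \<and> (case p of (x, y) \<Rightarrow> e x + f y) = int n}"
    obtain x y where xy: "p = (x, y)" by (cases p)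
    have "x \<in> A" "y \<in> B" and eq: "e x + f y = int n" using p by (auto simp: xy)
    moreover have "0 \<le> e x" "0 \<le> f y" using calculation A(2) B(2) by auto
    ultimately have "p \<in> ?S (nat (e x))" "nat (e x) \<in> {0..n}" by (auto simp: xy)
    then show "p \<in> (\<Union>i\<in>{0..n}. ?S i)" by blast
  qed (auto simp: of_nat_diff)
  have "(theta_series A e w * theta_series B f v) $ n
      = (\<Sum>i=0..n. (\<Sum>x\<in>?FA (int i). w x) * (\<Sum>y\<in>?FB (int (n - i)). v y))"
    by (simp add: theta_series_def fps_mult_nth)
  also have "\<dots> = (\<Sum>i=0..n. \<Sum>(x, y)\<in>?S i. w x * v y)"
    by (simp add: sum_product sum.cartesian_product)
  also have "\<dots> = (\<Sum>(x, y)\<in>(\<Union>i\<in>{0..n}. ?S i). w x * v y)"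
    by (subst sum.UNION_disjoint) (auto simp: fin)
  also have "\<dots> = theta_series (A \<times> B) (\<lambda>(x, y). e x + f y) (\<lambda>(x, y). w x * v y) $ n"
    unfolding theta_series_def fps_nth_Abs_fps un ..
  finally show "(theta_series A e w * theta_series B f v) $ n
    = theta_series (A \<times> B) (\<lambda>(x, y). e x + f y) (\<lambda>(x, y). w x * v y) $ n" .
qed

lemma theta_series_reindex:
  assumes "bij_betw h A B" "\<And>x. x \<in> A \<Longrightarrow> f (h x) = e x" "\<And>x. x \<in> A \<Longrightarrow> v (h x) = w x"
  shows "theta_series A e w = theta_series B f v"
proof (rule fps_ext)
  fix n
  have "bij_betw h {x. x \<in> A \<and> e x = int n} {y. y \<in> B \<and> f y = int n}"
    using assms(1,2) by (auto simp: bij_betw_def inj_on_def)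
  then have "(\<Sum>x\<in>{x. x \<in> A \<and> e x = int n}. v (h x)) = (\<Sum>y\<in>{y. y \<in> B \<and> f y = int n}. v y)"
    by (rule sum.reindex_bij_betw)
  then show "theta_series A e w $ n = theta_series B f v $ n"
    using assms(3) by (simp add: theta_series_def)
qed

lemma theta_series_cong:
  "(\<And>x. x \<in> A \<Longrightarrow> e x = f x) \<Longrightarrow> (\<And>x. x \<in> A \<Longrightarrow> w x = v x) \<Longrightarrow> theta_series A e w = theta_series A f v"
  using theta_series_reindex[of id A A f e v w] by simp

lemma theta_series_Un:
  assumes "finite_fibres (A \<union> B) e" "A \<inter> B = {}"
  shows "theta_series (A \<union> B) e w = theta_series A e w + theta_series B e w"
proof (rule fps_ext)
  fix n
  have "{x. x \<in> A \<union> B \<and> e x = int n} = {x. x \<in> A \<and> e x = int n} \<union> {x. x \<in> B \<and> e x = int n}"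
    by auto
  moreover have "finite {x. x \<in> A \<and> e x = int n}" "finite {x. x \<in> B \<and> e x = int n}"
    using finite_fibres_subset[OF assms(1)] by (auto simp: finite_fibres_def)
  ultimately show "theta_series (A \<union> B) e w $ n = (theta_series A e w + theta_series B e w) $ n"
    using assms(2) unfolding theta_series_def fps_nth_Abs_fps fps_add_nth
    by (simp only:) (subst sum.union_disjoint; auto)
qed

lemma theta_series_uminus: "theta_series A e (\<lambda>x. - w x) = - theta_series A e w"
  by (simp add: fps_eq_iff theta_series_def sum_negf)

lemma dilate_theta_series:
  assumes "k > 0"
  shows "dilate k (theta_series A e w) = theta_series A (\<lambda>x. int k * e x) w"
proof (rule fps_ext)
  fix n
  show "dilate k (theta_series A e w) $ n = theta_series A (\<lambda>x. int k * e x) w $ n"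
  proof (cases "k dvd n")
    case True
    then obtain m where "n = k * m" ..
    then show ?thesis using assms by (simp add: dilate_nth theta_series_def)
  next
    case False
    have "int k * e x \<noteq> int n" for x
      using False by (metis dvd_triv_left of_nat_dvd_iff)
    then show ?thesis using assms False by (simp add: dilate_nth theta_series_def)
  qed
qed

lemma X_power_mult_theta_series:
  assumes "\<And>x. x \<in> A \<Longrightarrow> 0 \<le> e x"
  shows "fps_X ^ j * theta_series A e w = theta_series A (\<lambda>x. e x + int j) w"
proof (rule fps_ext)
  fix n
  show "(fps_X ^ j * theta_series A e w) $ n = theta_series A (\<lambda>x. e x + int j) w $ n"
  proof (cases "n < j")
    case True
    then have "{x. x \<in> A \<and> e x + int j = int n} = {}" using assms by fastforce
    then have "theta_series A (\<lambda>x. e x + int j) w $ n = 0"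
      unfolding theta_series_def fps_nth_Abs_fps by (simp only: sum.empty)
    then show ?thesis using True by (simp add: fps_X_power_mult_nth)
  next
    case False
    then have "{x. x \<in> A \<and> e x + int j = int n} = {x. x \<in> A \<and> e x = int (n - j)}" by auto
    then show ?thesis using False unfolding theta_series_def
      by (simp add: fps_X_power_mult_nth)
  qed
qed

lemma X_mult_theta_series:
  "(\<And>x. x \<in> A \<Longrightarrow> 0 \<le> e x) \<Longrightarrow> fps_X * theta_series A e w = theta_series A (\<lambda>x. e x + 1) w"
  using X_power_mult_theta_series[of A e 1 w] by simp

lemma parity_sign_of_nat: "parity_sign (int n) = (-1) ^ n"
  by (simp add: parity_sign_def)

lemma negate_X_theta_series:
  "negate_X (theta_series A e w) = theta_series A e (\<lambda>x. parity_sign (e x) * w x)"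
  by (rule fps_ext) (auto simp: theta_series_def sum_distrib_left parity_sign_of_nat intro!: sum.cong)

section \<open>The classical theta series and their dissections\<close>

definition phi :: "int fps" where
  "phi = theta_series UNIV (\<lambda>x. x\<^sup>2) (\<lambda>_. 1)"

definition triangular :: "int \<Rightarrow> int" where
  "triangular y = y * (y + 1) div 2"

text \<open>
  Ramanujan's \<open>\<psi>(q) = 1 + q + q^3 + q^6 + ...\<close>.  Every triangular number is hit twice by the integers,
  which accounts for the factors 2 below.
\<close>

definition psi :: "int fps" where
  "psi = theta_series {0..} triangular (\<lambda>_. 1)"

definition omega_exponent :: "int \<Rightarrow> int" where
  "omega_exponent x = 3 * x\<^sup>2 - 2 * x"

text \<open>
  The cofactor in the 3-dissection of \<open>\<phi>\<close>: the squares not divisible by 3 are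
  \<open>(3x - 1)^2 = 3 (3x^2 - 2x) + 1\<close>.
\<close>

definition omega :: "int fps" where
  "omega = theta_series UNIV omega_exponent (\<lambda>_. 1)"

definition pentagonal :: "int \<Rightarrow> int" where
  "pentagonal y = y * (3 * y + 1) div 2"

text \<open>
  The series over generalized pentagonal numbers with all signs positive; with \<open>q^3\<close> for \<open>q\<close> it is the
  part of \<open>\<psi>\<close> with exponents divisible by 3.
\<close>

definition pent :: "int fps" where
  "pent = theta_series UNIV pentagonal (\<lambda>_. 1)"

lemma double_triangular: "2 * triangular y = y\<^sup>2 + y"
  by (simp add: triangular_def power2_eq_square algebra_simps)

lemma double_pentagonal: "2 * pentagonal y = 3 * y\<^sup>2 + y"
proof -
  have "even (y * (3 * y + 1))" by simp
  then show ?thesis by (simp add: pentagonal_def power2_eq_square algebra_simps)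
qed

lemma exponent_bounds:
  "\<bar>y\<bar> \<le> triangular y + 2" "0 \<le> triangular y"
  "\<bar>y\<bar> \<le> pentagonal y" "0 \<le> pentagonal y"
  "\<bar>y\<bar> \<le> omega_exponent y" "0 \<le> omega_exponent y"
  \<comment> \<open>\<open>(2y + 3)^2 \<ge> 0\<close> gives the bound on \<open>triangular y\<close> for negative \<open>y\<close>.\<close>
  using abs_le_square_int[of y] double_triangular[of y] double_pentagonal[of y]
    zero_le_power2[of "2 * y + 3"]
  unfolding power2_sum power_mult_distrib
  by (auto simp: omega_exponent_def)

lemma finite_fibres_exponents:
  "finite_fibres A (\<lambda>x :: int. x\<^sup>2)" "finite_fibres A triangular"
  "finite_fibres A pentagonal" "finite_fibres A omega_exponent"
proof -
  have "\<bar>x\<bar> \<le> x\<^sup>2 + 2" "\<bar>x\<bar> \<le> triangular x + 2" "\<bar>x\<bar> \<le> pentagonal x + 2"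
    "\<bar>x\<bar> \<le> omega_exponent x + 2" for x :: int
    using abs_le_square_int[of x] exponent_bounds[of x] by linarith+
  then show "finite_fibres A (\<lambda>x :: int. x\<^sup>2)" "finite_fibres A triangular"
    "finite_fibres A pentagonal" "finite_fibres A omega_exponent"
    by (blast intro: finite_fibres_int)+
qed

lemma theta_eq_negate_X_phi: "theta = negate_X phi"
  unfolding theta_def phi_def negate_X_theta_series
  by (rule theta_series_cong) (auto simp: parity_sign_def)

lemma negate_X_omega:
  "negate_X omega = theta_series UNIV omega_exponent parity_sign"
  unfolding omega_def negate_X_theta_series
  by (rule theta_series_cong) (auto simp: parity_sign_def omega_exponent_def)

lemma bilateral_triangular: "theta_series UNIV triangular (\<lambda>_. 1) = 2 * psi"
proof -
  have "theta_series UNIV triangular (\<lambda>_. 1) = theta_series ({0..} \<union> {..<0}) triangular (\<lambda>_. 1)"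
    by (rule arg_cong[of _ _ "\<lambda>A. theta_series A _ _"]) auto
  also have "\<dots> = theta_series {0..} triangular (\<lambda>_. 1) + theta_series {..<0} triangular (\<lambda>_. 1)"
    by (rule theta_series_Un) (auto simp: finite_fibres_exponents)
  also have "theta_series {..<0} triangular (\<lambda>_. 1) = theta_series {0..} triangular (\<lambda>_. 1)"
  proof (rule theta_series_reindex)
    show "bij_betw (\<lambda>y. - 1 - y) {..<0} {0::int..}"
      by (rule bij_betw_byWitness[where f' = "\<lambda>y. - 1 - y"]) auto
    fix y :: int
    have "(- 1 - y) * (- 1 - y + 1) = y * (y + 1)" by (simp add: algebra_simps)
    then show "triangular (- 1 - y) = triangular y" by (simp only: triangular_def)
  qed simp
  finally show ?thesis by (simp add: psi_def)
qed

lemma phi_0 [simp]: "phi $ 0 = 1"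
  by (simp add: phi_def theta_series_def)

lemma theta_0 [simp]: "theta $ 0 = 1"
  by (simp add: theta_eq_negate_X_phi)

lemma psi_0 [simp]: "psi $ 0 = 1"
proof -
  have "triangular y = 0 \<longleftrightarrow> y = 0" if "0 \<le> y" for y
    using that double_triangular[of y] by (auto simp: power2_eq_square add_nonneg_eq_0_iff)
  then have "{y. y \<in> {0..} \<and> triangular y = int 0} = {0}" by auto
  then show ?thesis unfolding psi_def theta_series_def fps_nth_Abs_fps by simp
qed

lemma int_split_2:
  fixes e :: "int \<Rightarrow> int"
  assumes "finite_fibres UNIV e"
  shows "theta_series UNIV e w = theta_series UNIV (\<lambda>u. e (2 * u)) (\<lambda>u. w (2 * u))
    + theta_series UNIV (\<lambda>u. e (2 * u + 1)) (\<lambda>u. w (2 * u + 1))"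
proof -
  have "theta_series UNIV e w = theta_series ({x. even x} \<union> {x. odd x}) e w"
    by (rule arg_cong[of _ _ "\<lambda>A. theta_series A _ _"]) auto
  also have "\<dots> = theta_series {x. even x} e w + theta_series {x. odd x} e w"
    by (rule theta_series_Un) (auto intro: finite_fibres_subset[OF assms])
  also have "theta_series {x. even x} e w = theta_series UNIV (\<lambda>u. e (2 * u)) (\<lambda>u. w (2 * u))"
    by (rule theta_series_reindex[symmetric, where h = "\<lambda>u. 2 * u"], rule bij_betw_byWitness[where f' = "\<lambda>x. x div 2"]) auto
  also have "theta_series {x. odd x} e w = theta_series UNIV (\<lambda>u. e (2 * u + 1)) (\<lambda>u. w (2 * u + 1))"
    by (rule theta_series_reindex[symmetric, where h = "\<lambda>u. 2 * u + 1"], rule bij_betw_byWitness[where f' = "\<lambda>x. x div 2"]) auto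
  finally show ?thesis .
qed

text \<open>
  The class of 2 modulo 3 is parametrized by \<open>-3u - 1\<close>, so that squares agree with those at \<open>3u + 1\<close> and
  triangular numbers with those at \<open>3u\<close>.
\<close>

lemma int_split_3:
  fixes e :: "int \<Rightarrow> int"
  assumes "finite_fibres UNIV e"
  shows "theta_series UNIV e w = theta_series UNIV (\<lambda>u. e (3 * u)) (\<lambda>u. w (3 * u))
    + theta_series UNIV (\<lambda>u. e (3 * u + 1)) (\<lambda>u. w (3 * u + 1))
    + theta_series UNIV (\<lambda>u. e (- 3 * u - 1)) (\<lambda>u. w (- 3 * u - 1))"
proof -
  let ?R = "\<lambda>r. {x :: int. x mod 3 = r}"
  have "theta_series UNIV e w = theta_series (?R 0 \<union> ?R 1 \<union> ?R 2) e w"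
    by (rule arg_cong[of _ _ "\<lambda>A. theta_series A _ _"]) auto
  also have "\<dots> = theta_series (?R 0) e w + theta_series (?R 1) e w + theta_series (?R 2) e w"
    by (subst theta_series_Un, rule finite_fibres_subset[OF assms], simp, force,
        subst theta_series_Un, rule finite_fibres_subset[OF assms]) auto
  also have "theta_series (?R 0) e w = theta_series UNIV (\<lambda>u. e (3 * u)) (\<lambda>u. w (3 * u))"
    by (rule theta_series_reindex[symmetric, where h = "\<lambda>u. 3 * u"], rule bij_betw_byWitness[where f' = "\<lambda>x. x div 3"]) auto
  also have "theta_series (?R 1) e w = theta_series UNIV (\<lambda>u. e (3 * u + 1)) (\<lambda>u. w (3 * u + 1))"
    by (rule theta_series_reindex[symmetric, where h = "\<lambda>u. 3 * u + 1"], rule bij_betw_byWitness[where f' = "\<lambda>x. x div 3"]) (auto, presburger+)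
  also have "theta_series (?R 2) e w = theta_series UNIV (\<lambda>u. e (- 3 * u - 1)) (\<lambda>u. w (- 3 * u - 1))"
    by (rule theta_series_reindex[symmetric, where h = "\<lambda>u. - 3 * u - 1"], rule bij_betw_byWitness[where f' = "\<lambda>x. (- x - 1) div 3"]) (auto, presburger+)
  finally show ?thesis .
qed

lemma phi_2_dissection: "phi = dilate 4 phi + 2 * fps_X * dilate 8 psi"
proof -
  have "2 * fps_X * dilate 8 psi = fps_X * dilate 8 (theta_series UNIV triangular (\<lambda>_. 1))"
    by (simp add: bilateral_triangular ac_simps)
  also have "\<dots> = theta_series UNIV (\<lambda>u. (2 * u + 1)\<^sup>2) (\<lambda>_. 1)"
    unfolding dilate_theta_series[OF zero_less_numeral]
  proof (subst X_mult_theta_series)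
    have "int 8 * triangular u + 1 = (2 * u + 1)\<^sup>2" for u
      using double_triangular[of u] by (simp add: power2_eq_square algebra_simps)
    then show "theta_series UNIV (\<lambda>u. int 8 * triangular u + 1) (\<lambda>_. 1)
        = theta_series UNIV (\<lambda>u. (2 * u + 1)\<^sup>2) (\<lambda>_. 1)"
      by (intro theta_series_cong) simp_all
  qed (use exponent_bounds in simp)
  finally have "2 * fps_X * dilate 8 psi = theta_series UNIV (\<lambda>u. (2 * u + 1)\<^sup>2) (\<lambda>_. 1)" .
  moreover have "dilate 4 phi = theta_series UNIV (\<lambda>u. (2 * u)\<^sup>2) (\<lambda>_. 1)"
    unfolding phi_def dilate_theta_series[OF zero_less_numeral]
    by (rule theta_series_cong) (auto simp: power_mult_distrib)
  ultimately show ?thesis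
    using int_split_2[OF finite_fibres_exponents(1), of "\<lambda>_. 1", folded phi_def] by (simp only:)
qed

lemma phi_3_dissection: "phi = dilate 9 phi + 2 * fps_X * dilate 3 omega"
proof -
  have "fps_X * dilate 3 omega = theta_series UNIV (\<lambda>u. 3 * omega_exponent u + 1) (\<lambda>_. 1)"
    unfolding omega_def dilate_theta_series[OF zero_less_numeral]
    by (subst X_mult_theta_series) (use exponent_bounds in auto)
  then have 1: "theta_series UNIV (\<lambda>u. (- 3 * u - 1)\<^sup>2) (\<lambda>_. 1) = fps_X * dilate 3 omega"
      "theta_series UNIV (\<lambda>u. (3 * u + 1)\<^sup>2) (\<lambda>_. 1) = fps_X * dilate 3 omega"
    by (simp_all only:)
      (rule theta_series_reindex[where h = uminus, OF bij_uminus];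
        simp add: omega_exponent_def power2_eq_square algebra_simps)+
  have 2: "dilate 9 phi = theta_series UNIV (\<lambda>u. (3 * u)\<^sup>2) (\<lambda>_. 1)"
    unfolding phi_def dilate_theta_series[OF zero_less_numeral]
    by (rule theta_series_cong) (auto simp: power_mult_distrib)
  show ?thesis
    unfolding 2 using int_split_3[OF finite_fibres_exponents(1), of "\<lambda>_. 1"]
    unfolding 1 phi_def[symmetric] by (simp add: algebra_simps)
qed

lemma psi_3_dissection: "psi = dilate 3 pent + fps_X * dilate 9 psi"
proof -
  have "2 * (fps_X * dilate 9 psi) = fps_X * dilate 9 (theta_series UNIV triangular (\<lambda>_. 1))"
    by (simp add: bilateral_triangular ac_simps)
  also have "\<dots> = theta_series UNIV (\<lambda>u. triangular (3 * u + 1)) (\<lambda>_. 1)"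
    unfolding dilate_theta_series[OF zero_less_numeral]
  proof (subst X_mult_theta_series)
    have "int 9 * triangular u + 1 = triangular (3 * u + 1)" for u
      using double_triangular[of u] double_triangular[of "3 * u + 1"]
      by (simp add: power2_eq_square algebra_simps)
    then show "theta_series UNIV (\<lambda>u. int 9 * triangular u + 1) (\<lambda>_. 1)
        = theta_series UNIV (\<lambda>u. triangular (3 * u + 1)) (\<lambda>_. 1)"
      by (intro theta_series_cong) simp_all
  qed (simp add: exponent_bounds)
  finally have 1: "theta_series UNIV (\<lambda>u. triangular (3 * u + 1)) (\<lambda>_. 1) = 2 * (fps_X * dilate 9 psi)" ..
  have tp: "triangular (3 * u) = 3 * pentagonal u" "triangular (- 3 * u - 1) = 3 * pentagonal u" for u
    using double_triangular[of "3 * u"] double_triangular[of "- 3 * u - 1"] double_pentagonal[of u]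
    by (simp_all add: power2_eq_square algebra_simps)
  have 2: "theta_series UNIV (\<lambda>u. triangular (3 * u)) (\<lambda>_. 1) = dilate 3 pent"
    "theta_series UNIV (\<lambda>u. triangular (- 3 * u - 1)) (\<lambda>_. 1) = dilate 3 pent"
    unfolding tp pent_def dilate_theta_series[OF zero_less_numeral] by simp_all
  have "2 * psi = 2 * (dilate 3 pent + fps_X * dilate 9 psi)"
    using int_split_3[OF finite_fibres_exponents(2), of "\<lambda>_. 1"]
    unfolding 1 2 bilateral_triangular by (simp add: algebra_simps)
  then show ?thesis by (simp only: mult_cancel_left) simp
qed

text \<open>
  Among the pairs \<open>(x, y)\<close> with sign \<open>(-1)^y\<close>, those of different parity cancel under
  swapping, and the others are \<open>(u + v, u - v)\<close> with \<open>x^2 + y^2 = 2 u^2 + 2 v^2\<close>.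
\<close>

lemma phi_mult_theta: "phi * theta = (dilate 2 theta) ^ 2"
proof -
  let ?e = "\<lambda>(x, y). x\<^sup>2 + y\<^sup>2 :: int" and ?w = "\<lambda>(x, y). 1 * parity_sign y"
  let ?E = "{(x, y). even (x + y :: int)}" and ?D = "{(x, y). odd (x + y :: int)}"
  have fin: "finite_fibres A ?e" for A
    by (rule finite_fibres_int_pair[where m = 1 and c = 0]) auto
  have "phi * theta = theta_series (UNIV \<times> UNIV) ?e ?w"
    unfolding phi_def theta_def by (rule theta_series_mult) (auto simp: finite_fibres_exponents)
  also have "UNIV \<times> UNIV = ?E \<union> ?D" by auto
  also have "theta_series (?E \<union> ?D) ?e ?w = theta_series ?E ?e ?w + theta_series ?D ?e ?w"
    by (rule theta_series_Un[OF fin]) auto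
  also have "theta_series ?D ?e ?w = 0"
  proof -
    have "theta_series ?D ?e ?w = theta_series ?D ?e (\<lambda>p. - ?w p)"
      by (rule theta_series_reindex[where h = "\<lambda>(x, y). (y, x)"],
          rule bij_betw_byWitness[where f' = "\<lambda>(x, y). (y, x)"]) (auto simp: parity_sign_def)
    then have "2 * theta_series ?D ?e ?w = 0" unfolding theta_series_uminus by simp
    then show ?thesis by simp
  qed
  also have "theta_series ?E ?e ?w = theta_series (UNIV \<times> UNIV)
      (\<lambda>(x, y). 2 * x\<^sup>2 + 2 * y\<^sup>2) (\<lambda>(x, y). parity_sign x * parity_sign y)"
  proof (rule theta_series_reindex[symmetric])
    have "(x + y) div 2 + (x - y) div 2 = x" "(x + y) div 2 - (x - y) div 2 = y"
      if "even (x + y)" for x y :: int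
      using that by presburger+
    then show "bij_betw (\<lambda>(u, v). (u + v, u - v)) (UNIV \<times> UNIV) ?E"
      by (intro bij_betw_byWitness[where f' = "\<lambda>(x, y). ((x + y) div 2, (x - y) div 2)"]) auto
  next
    fix p :: "int \<times> int"
    obtain u v where p: "p = (u, v)" by (cases p)
    show "?e (case p of (u, v) \<Rightarrow> (u + v, u - v)) = (case p of (x, y) \<Rightarrow> 2 * x\<^sup>2 + 2 * y\<^sup>2)"
      by (simp add: p power2_sum power2_diff)
    show "?w (case p of (u, v) \<Rightarrow> (u + v, u - v)) = (case p of (x, y) \<Rightarrow> parity_sign x * parity_sign y)"
      by (simp add: p parity_sign_def)
  qed
  also have "\<dots> = dilate 2 theta * dilate 2 theta"
    unfolding theta_def dilate_theta_series[OF zero_less_numeral]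
  proof -
    have "\<bar>x\<bar> \<le> int 2 * x\<^sup>2 + 0" for x
      using abs_le_square_int[of x] by simp
    then have "finite_fibres UNIV (\<lambda>x. int 2 * x\<^sup>2)" by (rule finite_fibres_int)
    then show "theta_series (UNIV \<times> UNIV) (\<lambda>(x, y). 2 * x\<^sup>2 + 2 * y\<^sup>2) (\<lambda>(x, y). parity_sign x * parity_sign y)
      = theta_series UNIV (\<lambda>x. int 2 * x\<^sup>2) parity_sign * theta_series UNIV (\<lambda>x. int 2 * x\<^sup>2) parity_sign"
      by (subst theta_series_mult) simp_all
  qed
  finally show ?thesis by (simp add: power2_eq_square)
qed

section \<open>Two identities from rotations of binary quadratic forms\<close>

text \<open>
  Up to constant factors, both sides count, with sign \<open>(-1)^X\<close>, representations \<open>24n + 9 = 8 X^2 + Y^2\<close> with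
  \<open>Y\<close> odd: the left side those with \<open>X\<close> and \<open>Y\<close> divisible by 3, the right side those with both
  prime to 3.  In the ring generated by the square root of -2, the number \<open>Y + 2X \<surd>-2\<close> has norm \<open>8 X^2 + Y^2\<close>, and multiplication by the element
  \<open>(1 + \<surd>-2)^2 / 3 = (-1 + 2 \<surd>-2) / 3\<close> of norm 1 maps the representations with \<open>Y \<equiv> X\<close> modulo 3
  onto those with \<open>Y \<equiv> -X\<close> and changes the parity of \<open>X\<close>.  With \<open>Z\<close> the signed count for the class divisible
  by 3, and \<open>S\<close> the signed count for \<open>Y \<equiv> X\<close> prime to 3, which is also that for \<open>Y \<equiv> -X\<close>, this says
  \<open>Z + S = -(Z + S)\<close>, so \<open>Z = -S\<close>; and \<open>Z\<close> is twice the left side, \<open>-S\<close> twice the right side.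
\<close>

lemma pent_mult_negate_X_omega: "dilate 3 theta * dilate 3 psi = pent * negate_X omega"
proof -
  let ?e = "\<lambda>(x, y). (8 * x\<^sup>2 + y\<^sup>2 - 9) div 24 :: int" and ?w = "\<lambda>(x :: int, y :: int). parity_sign x"
  let ?T = "\<lambda>A. theta_series A ?e ?w"
  let ?P = "{(x :: int, y :: int). odd y \<and> 3 dvd y - x}" and ?M = "{(x :: int, y :: int). odd y \<and> 3 dvd y + x}"
  let ?Z = "{(x :: int, y :: int). odd y \<and> 3 dvd x \<and> 3 dvd y}"
  let ?P' = "{(x :: int, y :: int). odd y \<and> 3 dvd y - x \<and> \<not> 3 dvd x}"
  let ?M1 = "{(x :: int, y :: int). odd y \<and> 3 dvd y + x \<and> x mod 3 = 2}"
  let ?M2 = "{(x :: int, y :: int). odd y \<and> 3 dvd y + x \<and> x mod 3 = 1}"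
  have fin: "finite_fibres A ?e" for A
  proof (rule finite_fibres_int_pair)
    fix x y :: int
    have "q - 9 \<le> 24 * ((q - 9) div 24) + 23" for q :: int by presburger
    from this[of "8 * x\<^sup>2 + y\<^sup>2"] show "x\<^sup>2 + y\<^sup>2 \<le> 24 * ?e (x, y) + 32"
      using zero_le_power2[of x] unfolding prod.case by linarith
  qed
  have rotate: "?T ?P = - ?T ?M"
    unfolding theta_series_uminus[symmetric]
  proof (rule theta_series_reindex)
    \<comment> \<open>Multiplication by \<open>(-1 + 2 \<surd>-2) / 3\<close> and, as inverse, by its conjugate.\<close>
    let ?h = "\<lambda>(x, y). ((y - x) div 3, (- y - 8 * x) div 3) :: int \<times> int"
    let ?h' = "\<lambda>(x, y). ((- y - x) div 3, (8 * x - y) div 3) :: int \<times> int"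
    have h: "?h (x, x + 3 * k) = (k, - 3 * x - k)" for x k
    proof -
      have "- (x + 3 * k) - 8 * x = 3 * (- 3 * x - k)" by simp
      then show ?thesis by (simp only: prod.case) simp
    qed
    have h': "?h' (k, - k - 3 * x) = (x, x + 3 * k)" for x k
    proof -
      have "8 * k - (- k - 3 * x) = 3 * (x + 3 * k)" by simp
      then show ?thesis by (simp only: prod.case) simp
    qed
    have P: "\<exists>x k. p = (x, x + 3 * k) \<and> odd (x + k)" if mem: "p \<in> ?P" for p
    proof -
      obtain x y where p: "p = (x, y)" "odd y" "3 dvd y - x" using mem by auto
      from p(3) obtain k where "y - x = 3 * k" ..
      then have "y = x + 3 * k" by simp
      then show ?thesis using p by auto
    qed
    have M: "\<exists>x k. p = (k, - k - 3 * x) \<and> odd (x + k)" if mem: "p \<in> ?M" for p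
    proof -
      obtain x y where p: "p = (x, y)" "odd y" "3 dvd y + x" using mem by auto
      from p(3) obtain k where "y + x = 3 * k" ..
      then have "y = - x - 3 * (- k)" by simp
      then show ?thesis using p by fastforce
    qed
    show "bij_betw ?h ?P ?M"
    proof (rule bij_betw_byWitness[where f' = ?h'])
      show "\<forall>p\<in>?P. ?h' (?h p) = p"
      proof
        fix p assume "p \<in> ?P"
        then obtain x k where p: "p = (x, x + 3 * k)" using P by blast
        show "?h' (?h p) = p" unfolding p h using h'[of k x] by (simp add: algebra_simps)
      qed
      show "\<forall>p\<in>?M. ?h (?h' p) = p"
      proof
        fix p assume "p \<in> ?M"
        then obtain x k where p: "p = (k, - k - 3 * x)" using M by blast
        show "?h (?h' p) = p" unfolding p h' h by simp
      qed
      show "?h ` ?P \<subseteq> ?M"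
      proof (rule image_subsetI)
        fix p assume "p \<in> ?P"
        then obtain x k where p: "p = (x, x + 3 * k)" "odd (x + k)" using P by blast
        then show "?h p \<in> ?M" unfolding p h by simp
      qed
      show "?h' ` ?M \<subseteq> ?P"
      proof (rule image_subsetI)
        fix p assume "p \<in> ?M"
        then obtain x k where p: "p = (k, - k - 3 * x)" "odd (x + k)" using M by blast
        then show "?h' p \<in> ?P" unfolding p h' by simp
      qed
    qed
    fix p assume "p \<in> ?P"
    then obtain x k where p: "p = (x, x + 3 * k)" "odd (x + k)" using P by blast
    have "8 * k\<^sup>2 + (- 3 * x - k)\<^sup>2 = 8 * x\<^sup>2 + (x + 3 * k)\<^sup>2"
      by (simp add: power2_eq_square algebra_simps)
    then show "?e (?h p) = ?e p" unfolding p h by simp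
    show "- ?w (?h p) = ?w p" using p(2) unfolding p h by (simp add: parity_sign_def)
  qed
  have T_P: "?T ?P = ?T ?Z + ?T ?P'"
  proof -
    have "?P = ?Z \<union> ?P'" by (auto; presburger)
    then show ?thesis using theta_series_Un[OF fin, of ?Z ?P' ?w] by auto
  qed
  have T_M: "?T ?M = ?T ?Z + (?T ?M1 + ?T ?M2)"
  proof -
    have "?M = ?Z \<union> (?M1 \<union> ?M2)" by (auto; presburger)
    moreover have "?T (?Z \<union> (?M1 \<union> ?M2)) = ?T ?Z + ?T (?M1 \<union> ?M2)"
      by (rule theta_series_Un[OF fin]) auto
    moreover have "?T (?M1 \<union> ?M2) = ?T ?M1 + ?T ?M2"
      by (rule theta_series_Un[OF fin]) auto
    ultimately show ?thesis by simp
  qed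
  have P': "?T ?P' = ?T ?M1 + ?T ?M2"
  proof -
    have "?T ?P' = ?T (?M1 \<union> ?M2)"
    proof (rule theta_series_reindex)
      show "bij_betw (\<lambda>(x, y). (x, - y)) ?P' (?M1 \<union> ?M2)"
        by (rule bij_betw_byWitness[where f' = "\<lambda>(x, y). (x, - y)"]; auto; presburger)
    qed auto
    also have "\<dots> = ?T ?M1 + ?T ?M2"
      by (rule theta_series_Un[OF fin]) auto
    finally show ?thesis .
  qed
  have M12: "?T ?M2 = ?T ?M1"
  proof (rule theta_series_reindex)
    show "bij_betw (\<lambda>(x, y). (- x, - y)) ?M2 ?M1"
      by (rule bij_betw_byWitness[where f' = "\<lambda>(x, y). (- x, - y)"]; auto; presburger)
  qed (auto simp: parity_sign_def)
  have M1: "?T ?M1 = - (pent * negate_X omega)"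
  proof -
    have "pent * negate_X omega = theta_series (UNIV \<times> UNIV)
        (\<lambda>(y, x). pentagonal y + omega_exponent x) (\<lambda>(y, x). 1 * parity_sign x)"
      unfolding pent_def negate_X_omega
      by (rule theta_series_mult) (auto simp: finite_fibres_exponents exponent_bounds)
    also have "\<dots> = theta_series ?M1 ?e (\<lambda>p. - ?w p)"
    proof (rule theta_series_reindex)
      show "bij_betw (\<lambda>(y, x). (3 * x - 1, 6 * y + 1)) (UNIV \<times> UNIV) ?M1"
      proof (rule bij_betw_byWitness[where f' = "\<lambda>(x, y). ((y - 1) div 6, (x + 1) div 3)"])
        have "3 * ((x + 1) div 3) - 1 = x" "6 * ((y - 1) div 6) + 1 = y"
          if "odd y" "3 dvd y + x" "x mod 3 = 2" for x y :: int
          using that by presburger+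
        then show "\<forall>p\<in>?M1. (case case p of (x, y) \<Rightarrow> ((y - 1) div 6, (x + 1) div 3) of
            (y, x) \<Rightarrow> (3 * x - 1, 6 * y + 1)) = p"
          by auto
        have "3 dvd 6 * y + 1 + (3 * x - 1)" "(3 * x - 1) mod 3 = 2" for x y :: int
          by presburger+
        then show "(\<lambda>(y, x). (3 * x - 1, 6 * y + 1)) ` (UNIV \<times> UNIV) \<subseteq> ?M1"
          by auto
      qed auto
    next
      fix p :: "int \<times> int"
      obtain y x where p: "p = (y, x)" by (cases p)
      have "8 * (3 * x - 1)\<^sup>2 + (6 * y + 1)\<^sup>2 - 9 = 24 * (pentagonal y + omega_exponent x)"
        using double_pentagonal[of y]
        by (simp add: omega_exponent_def power2_eq_square algebra_simps)
      then show "?e (case p of (y, x) \<Rightarrow> (3 * x - 1, 6 * y + 1))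
          = (case p of (y, x) \<Rightarrow> pentagonal y + omega_exponent x)"
        by (simp add: p)
      show "- ?w (case p of (y, x) \<Rightarrow> (3 * x - 1, 6 * y + 1)) = (case p of (y, x) \<Rightarrow> 1 * parity_sign x)"
        by (simp add: p parity_sign_def)
    qed
    finally show ?thesis by (simp add: theta_series_uminus)
  qed
  have Z: "?T ?Z = dilate 3 theta * (2 * dilate 3 psi)"
  proof -
    have "dilate 3 theta * (2 * dilate 3 psi)
        = dilate 3 theta * dilate 3 (theta_series UNIV triangular (\<lambda>_. 1))"
      by (simp add: bilateral_triangular)
    also have "\<dots> = theta_series (UNIV \<times> UNIV)
        (\<lambda>(x, y). int 3 * x\<^sup>2 + int 3 * triangular y) (\<lambda>(x, y). parity_sign x * 1)"
      unfolding theta_def dilate_theta_series[OF zero_less_numeral]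
    proof (rule theta_series_mult)
      have "\<bar>x\<bar> \<le> int 3 * x\<^sup>2 + 2" "\<bar>x\<bar> \<le> int 3 * triangular x + 2" for x
        using abs_le_square_int[of x] exponent_bounds[of x] by simp_all
      then show "finite_fibres UNIV (\<lambda>x. int 3 * x\<^sup>2)" "finite_fibres UNIV (\<lambda>x. int 3 * triangular x)"
        by (blast intro: finite_fibres_int)+
    qed (simp_all add: exponent_bounds)
    also have "\<dots> = ?T ?Z"
    proof (rule theta_series_reindex)
      have "3 * (x div 3) = x" "3 * (2 * (y div 3 div 2) + 1) = y"
        if "odd y" "3 dvd x" "3 dvd y" for x y :: int
        using that by presburger+
      moreover have "odd (3 * (2 * y + 1))" for y :: int by presburger
      ultimately show "bij_betw (\<lambda>(x, y). (3 * x, 3 * (2 * y + 1))) (UNIV \<times> UNIV) ?Z"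
        by (intro bij_betw_byWitness[where f' = "\<lambda>(x, y). (x div 3, y div 3 div 2)"]) auto
    next
      fix p :: "int \<times> int"
      obtain x y where p: "p = (x, y)" by (cases p)
      have "8 * (3 * x)\<^sup>2 + (3 * (2 * y + 1))\<^sup>2 - 9 = 24 * (3 * x\<^sup>2 + 3 * triangular y)"
        using double_triangular[of y] by (simp add: power2_eq_square algebra_simps)
      then show "?e (case p of (x, y) \<Rightarrow> (3 * x, 3 * (2 * y + 1)))
          = (case p of (x, y) \<Rightarrow> int 3 * x\<^sup>2 + int 3 * triangular y)"
        by (simp add: p)
      show "?w (case p of (x, y) \<Rightarrow> (3 * x, 3 * (2 * y + 1))) = (case p of (x, y) \<Rightarrow> parity_sign x * 1)"
        by (simp add: p parity_sign_def)
    qed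
    finally show ?thesis ..
  qed
  have "4 * (dilate 3 theta * dilate 3 psi) = 4 * (pent * negate_X omega)"
    using rotate unfolding T_P T_M P' M12 M1 Z by algebra
  then show ?thesis by (simp only: mult_cancel_left) simp
qed

text \<open>
  Writing \<open>z = 3y - 1\<close>, the left side counts solutions of \<open>3 x^2 + z^2 = 3n + 1\<close> with \<open>z \<equiv> 2\<close> modulo 3, that is,
  numbers \<open>z + x \<surd>-3\<close> of norm \<open>3n + 1\<close>.  If \<open>x\<close> and \<open>z\<close> have equal parity, multiplication by the cube root of
  unity \<open>(-1 + \<surd>-3) / 2\<close> permutes the solutions and moves \<open>x\<close> to the next class modulo 3, so their number
  is a multiple of 3.  If the parities differ, multiplication by twice a cube root of unity leads to
  \<open>3 v^2 + u^2 = 4 (3n + 1)\<close> with \<open>v\<close> odd, \<open>u \<equiv> 1\<close> modulo 6 and \<open>u + v\<close> divisible by 4.  For odd \<open>v\<close> exactly one of \<open>v\<close>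
  and \<open>-v\<close> satisfies the last condition, so these solutions are counted by the right side, where
  \<open>u = 6y + 1\<close> belongs to a pentagonal and \<open>v = 2t + 1\<close> to a triangular number.
\<close>

lemma phi_mult_omega_cong: "fps_cong 3 (phi * omega) (dilate 2 (pent * psi))"
proof -
  let ?e = "\<lambda>(x, z). (3 * x\<^sup>2 + z\<^sup>2 - 1) div 3 :: int"
  let ?f = "\<lambda>(v, u). (3 * v\<^sup>2 + u\<^sup>2 - 4) div 12 :: int"
  let ?T = "\<lambda>A. theta_series A ?e (\<lambda>_. 1)" and ?U = "\<lambda>A. theta_series A ?f (\<lambda>_. 1)"
  let ?C = "\<lambda>i. {(x :: int, z :: int). even (x + z) \<and> z mod 3 = 2 \<and> x mod 3 = i}"
  let ?E = "{(x :: int, z :: int). odd (x + z) \<and> z mod 3 = 2}"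
  let ?P = "{(v :: int, u :: int). odd v \<and> u mod 6 = 1 \<and> 4 dvd u + v}"
  let ?M = "{(v :: int, u :: int). odd v \<and> u mod 6 = 1 \<and> 4 dvd u - v}"
  have fin: "finite_fibres A ?e" for A
  proof (rule finite_fibres_int_pair)
    fix x z :: int
    have "q - 1 \<le> 3 * ((q - 1) div 3) + 2" for q :: int by presburger
    from this[of "3 * x\<^sup>2 + z\<^sup>2"] show "x\<^sup>2 + z\<^sup>2 \<le> 3 * ?e (x, z) + 3"
      using zero_le_power2[of x] unfolding prod.case by linarith
  qed
  have fin': "finite_fibres A ?f" for A
  proof (rule finite_fibres_int_pair)
    fix x z :: int
    have "q - 4 \<le> 12 * ((q - 4) div 12) + 11" for q :: int by presburger
    from this[of "3 * x\<^sup>2 + z\<^sup>2"] show "x\<^sup>2 + z\<^sup>2 \<le> 12 * ?f (x, z) + 15"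
      using zero_le_power2[of x] unfolding prod.case by linarith
  qed
  have rotate: "?T (?C i) = ?T (?C j)" if ij: "j = (i + 1) mod 3" "i \<in> {0, 1, 2}" for i j
  proof (rule theta_series_reindex)
    \<comment> \<open>Multiplication by \<open>(-1 + \<surd>-3) / 2\<close> and, as inverse, by its conjugate.\<close>
    let ?h = "\<lambda>(x, z). ((z - x) div 2, (- z - 3 * x) div 2) :: int \<times> int"
    let ?h' = "\<lambda>(x, z). ((- x - z) div 2, (3 * x - z) div 2) :: int \<times> int"
    have h: "?h (x, x + 2 * k) = (k, - 2 * x - k)" for x k
    proof -
      have "- (x + 2 * k) - 3 * x = 2 * (- 2 * x - k)" by simp
      then show ?thesis by (simp only: prod.case) simp
    qed
    have h': "?h' (k, - 2 * x - k) = (x, x + 2 * k)" for x k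
    proof -
      have "3 * k - (- 2 * x - k) = 2 * (x + 2 * k)" by simp
      then show ?thesis by (simp only: prod.case) simp
    qed
    have P: "\<exists>x k. p = (x, x + 2 * k) \<and> (x + 2 * k) mod 3 = 2 \<and> x mod 3 = i" if mem: "p \<in> ?C i" for p i
    proof -
      obtain x z where p: "p = (x, z)" "even (x + z)" "z mod 3 = 2" "x mod 3 = i" using mem by auto
      from p(2) have "z = x + 2 * ((z - x) div 2)" by presburger
      then show ?thesis using p by metis
    qed
    have M: "\<exists>x k. p = (k, - 2 * x - k) \<and> (- 2 * x - k) mod 3 = 2 \<and> k mod 3 = i" if mem: "p \<in> ?C i" for p i
    proof -
      obtain x z where p: "p = (x, z)" "even (x + z)" "z mod 3 = 2" "x mod 3 = i" using mem by auto
      from p(2) have "z = - 2 * ((- x - z) div 2) - x" by presburger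
      then show ?thesis using p by metis
    qed
    show "bij_betw ?h (?C i) (?C j)"
    proof (rule bij_betw_byWitness[where f' = ?h'])
      show "\<forall>p\<in>?C i. ?h' (?h p) = p"
      proof
        fix p assume "p \<in> ?C i"
        then obtain x k where p: "p = (x, x + 2 * k)" using P by blast
        show "?h' (?h p) = p" unfolding p h h' ..
      qed
      show "\<forall>p\<in>?C j. ?h (?h' p) = p"
      proof
        fix p assume "p \<in> ?C j"
        then obtain x k where p: "p = (k, - 2 * x - k)" using M by blast
        show "?h (?h' p) = p" unfolding p h' h ..
      qed
      show "?h ` ?C i \<subseteq> ?C j"
      proof (rule image_subsetI)
        fix p assume "p \<in> ?C i"
        then obtain x k where p: "p = (x, x + 2 * k)" "(x + 2 * k) mod 3 = 2" "x mod 3 = i"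
          using P by blast
        have "(- 2 * x - k) mod 3 = 2" using p(2) by presburger
        moreover have "k mod 3 = (x mod 3 + 1) mod 3" using p(2) by presburger
        ultimately have "(- 2 * x - k) mod 3 = 2 \<and> k mod 3 = j" using p(3) ij(1) by simp
        then show "?h p \<in> ?C j" unfolding p h by simp
      qed
      show "?h' ` ?C j \<subseteq> ?C i"
      proof (rule image_subsetI)
        fix p assume "p \<in> ?C j"
        then obtain x k where p: "p = (k, - 2 * x - k)" "(- 2 * x - k) mod 3 = 2" "k mod 3 = j"
          using M by blast
        have "(x + 2 * k) mod 3 = 2" using p(2) by presburger
        moreover have "x mod 3 = (k mod 3 + 2) mod 3" using p(2) by presburger
        then have "x mod 3 = i" using p(3) ij by auto
        ultimately have "(x + 2 * k) mod 3 = 2 \<and> x mod 3 = i" by simp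
        then show "?h' p \<in> ?C i" unfolding p h' by simp
      qed
    qed
    fix p assume "p \<in> ?C i"
    then obtain x k where p: "p = (x, x + 2 * k)" using P by blast
    have "3 * k\<^sup>2 + (- 2 * x - k)\<^sup>2 = 3 * x\<^sup>2 + (x + 2 * k)\<^sup>2"
      by (simp add: power2_eq_square algebra_simps)
    then show "?e (?h p) = ?e p" unfolding p h by simp
  qed simp
  have "phi * omega = theta_series (UNIV \<times> UNIV) (\<lambda>(x, y). x\<^sup>2 + omega_exponent y) (\<lambda>(x, y). 1 * 1)"
    unfolding phi_def omega_def
    by (rule theta_series_mult) (auto simp: finite_fibres_exponents exponent_bounds)
  also have "\<dots> = ?T {(x :: int, z :: int). z mod 3 = 2}"
  proof (rule theta_series_reindex)
    show "bij_betw (\<lambda>(x, y). (x, 3 * y - 1)) (UNIV \<times> UNIV) {(x :: int, z :: int). z mod 3 = 2}"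
      by (rule bij_betw_byWitness[where f' = "\<lambda>(x, z). (x, (z + 1) div 3)"]; auto; presburger)
  next
    fix p :: "int \<times> int"
    obtain x y where p: "p = (x, y)" by (cases p)
    have "3 * x\<^sup>2 + (3 * y - 1)\<^sup>2 - 1 = 3 * (x\<^sup>2 + omega_exponent y)"
      by (simp add: omega_exponent_def power2_eq_square algebra_simps)
    then show "?e (case p of (x, y) \<Rightarrow> (x, 3 * y - 1)) = (case p of (x, y) \<Rightarrow> x\<^sup>2 + omega_exponent y)"
      by (simp add: p)
  qed auto
  also have "{(x :: int, z :: int). z mod 3 = 2} = ?E \<union> (?C 0 \<union> (?C 1 \<union> ?C 2))"
    by auto
  also have "?T (?E \<union> (?C 0 \<union> (?C 1 \<union> ?C 2))) = ?T ?E + ?T (?C 0 \<union> (?C 1 \<union> ?C 2))"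
    by (rule theta_series_Un[OF fin]) auto
  also have "?T (?C 0 \<union> (?C 1 \<union> ?C 2)) = ?T (?C 0) + ?T (?C 1 \<union> ?C 2)"
    by (rule theta_series_Un[OF fin]) auto
  also have "?T (?C 1 \<union> ?C 2) = ?T (?C 1) + ?T (?C 2)"
    by (rule theta_series_Un[OF fin]) auto
  also have "?T (?C 1) = ?T (?C 0)" by (rule rotate[symmetric]) auto
  also have "?T (?C 2) = ?T (?C 0)" by (rule rotate) auto
  also have "?T ?E = dilate 2 (pent * psi)"
  proof -
    have "?T ?E = ?U ?P"
    proof (rule theta_series_reindex)
      show "bij_betw (\<lambda>(x, z). (z - x, - z - 3 * x)) ?E ?P"
      proof (rule bij_betw_byWitness[where f' = "\<lambda>(v, u). (- ((u + v) div 4), v - (u + v) div 4)"])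
        have "(- z - 3 * x + (z - x)) div 4 = - x" for x z :: int by presburger
        then show "\<forall>p\<in>?E. (case case p of (x, z) \<Rightarrow> (z - x, - z - 3 * x) of
            (v, u) \<Rightarrow> (- ((u + v) div 4), v - (u + v) div 4)) = p"
          by auto
        have "- (v - (u + v) div 4) + 3 * ((u + v) div 4) = u" if "4 dvd u + v" for u v :: int
          using that by presburger
        then show "\<forall>p\<in>?P. (case case p of (v, u) \<Rightarrow> (- ((u + v) div 4), v - (u + v) div 4) of
            (x, z) \<Rightarrow> (z - x, - z - 3 * x)) = p"
          by auto
        have "odd (z - x) \<and> (- z - 3 * x) mod 6 = 1 \<and> 4 dvd - z - 3 * x + (z - x)"
          if xz: "odd (x + z)" "z mod 3 = 2" for x z :: int
        proof -
          define m where "m = z div 3"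
          have z: "z = 3 * m + 2" using xz(2) by (simp add: m_def) presburger
          have "odd (m + x)" using xz(1) unfolding z by presburger
          then obtain t where "m + x = 2 * t + 1" by (elim oddE)
          then have "- z - 3 * x = 1 + 6 * (- t - 1)" unfolding z by simp
          then have "(- z - 3 * x) mod 6 = 1" by (simp only: mod_mult_self2) simp
          moreover have "- z - 3 * x + (z - x) = 4 * (- x)" by simp
          then have "4 dvd - z - 3 * x + (z - x)" by (simp only: dvd_triv_left)
          moreover have "odd (z - x)" using xz(1) by presburger
          ultimately show ?thesis by blast
        qed
        then show "(\<lambda>(x, z). (z - x, - z - 3 * x)) ` ?E \<subseteq> ?P" by auto
        have "odd (- ((u + v) div 4) + (v - (u + v) div 4)) \<and> (v - (u + v) div 4) mod 3 = 2"
          if uv: "odd v" "u mod 6 = 1" "4 dvd u + v" for u v :: int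
        proof -
          from uv(3) obtain k where "u + v = 4 * k" ..
          then have u: "u = 4 * k - v" by simp
          have "odd (- k + (v - k))" using uv(1) by presburger
          moreover have "(v - k) mod 3 = 2"
          proof -
            define m where "m = u div 6"
            have "u = 6 * m + 1" using uv(2) by (simp add: m_def) presburger
            then have "v - k = 2 + 3 * (k - 2 * m - 1)" using u by simp
            then show ?thesis by (simp only: mod_mult_self2) simp
          qed
          ultimately show ?thesis by (simp add: u)
        qed
        then show "(\<lambda>(v, u). (- ((u + v) div 4), v - (u + v) div 4)) ` ?P \<subseteq> ?E" by auto
      qed
    next
      fix p :: "int \<times> int"
      obtain x z where p: "p = (x, z)" by (cases p)
      have "3 * (z - x)\<^sup>2 + (- z - 3 * x)\<^sup>2 - 4 = 4 * (3 * x\<^sup>2 + z\<^sup>2 - 1)"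
        by (simp add: power2_eq_square algebra_simps)
      moreover have "4 * q div 12 = q div 3" for q :: int by presburger
      ultimately show "?f (case p of (x, z) \<Rightarrow> (z - x, - z - 3 * x)) = ?e p"
        by (simp add: p)
    qed simp
    moreover have "?U ?P = ?U ?M"
    proof (rule theta_series_reindex)
      show "bij_betw (\<lambda>(v, u). (- v, u)) ?P ?M"
        by (rule bij_betw_byWitness[where f' = "\<lambda>(v, u). (- v, u)"]) auto
    qed auto
    moreover have "?U (?P \<union> ?M) = ?U ?P + ?U ?M"
    proof (rule theta_series_Un[OF fin'])
      have False if "odd v" "4 dvd u + v" "4 dvd u - v" for u v :: int
        using that by presburger
      then show "?P \<inter> ?M = {}" by auto
    qed
    moreover have "?U (?P \<union> ?M) = 2 * dilate 2 (pent * psi)"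
    proof -
      have "2 * dilate 2 (pent * psi) = dilate 2 (pent * theta_series UNIV triangular (\<lambda>_. 1))"
        by (simp add: bilateral_triangular)
      also have "pent * theta_series UNIV triangular (\<lambda>_. 1) = theta_series (UNIV \<times> UNIV)
          (\<lambda>(y, t). pentagonal y + triangular t) (\<lambda>(y, t). 1 * 1)"
        unfolding pent_def
        by (rule theta_series_mult) (auto simp: finite_fibres_exponents exponent_bounds)
      also have "dilate 2 \<dots> = theta_series (UNIV \<times> UNIV)
          (\<lambda>p. int 2 * (case p of (y, t) \<Rightarrow> pentagonal y + triangular t)) (\<lambda>(y, t). 1 * 1)"
        by (rule dilate_theta_series) simp
      also have "\<dots> = ?U (?P \<union> ?M)"
      proof (rule theta_series_reindex)
        have PM: "?P \<union> ?M = {(v :: int, u :: int). odd v \<and> u mod 6 = 1}"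
          by (auto; presburger)
        have "6 * (u div 6) + 1 = u" if "u mod 6 = 1" for u :: int
          using mult_div_mod_eq[of 6 u] that by simp
        then show "bij_betw (\<lambda>(y, t). (2 * t + 1, 6 * y + 1)) (UNIV \<times> UNIV) (?P \<union> ?M)"
          unfolding PM
          by (intro bij_betw_byWitness[where f' = "\<lambda>(v, u). (u div 6, v div 2)"]) auto
      next
        fix p :: "int \<times> int"
        obtain y t where p: "p = (y, t)" by (cases p)
        have "3 * (2 * t + 1)\<^sup>2 + (6 * y + 1)\<^sup>2 - 4 = 12 * (2 * (pentagonal y + triangular t))"
          using double_pentagonal[of y] double_triangular[of t]
          by (simp add: power2_eq_square algebra_simps)
        then show "?f (case p of (y, t) \<Rightarrow> (2 * t + 1, 6 * y + 1))
            = int 2 * (case p of (y, t) \<Rightarrow> pentagonal y + triangular t)"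
          by (simp add: p)
      qed auto
      finally show ?thesis ..
    qed
    ultimately have "2 * ?T ?E = 2 * dilate 2 (pent * psi)" by simp
    then show ?thesis by (simp only: mult_cancel_left) simp
  qed
  finally have "phi * omega - dilate 2 (pent * psi) = 3 * ?T (?C 0)" by simp
  then show ?thesis by (simp add: fps_cong_3)
qed

section \<open>Congruences for overpartitions into parts not divisible by 4 or 3\<close>

lemma theta_2_dissection: "theta = dilate 4 phi - 2 * fps_X * dilate 8 psi"
  by (subst theta_eq_negate_X_phi, subst phi_2_dissection) simp

lemma theta_3_dissection: "theta = dilate 9 theta - 2 * fps_X * dilate 3 (negate_X omega)"
  by (subst (1) theta_eq_negate_X_phi, subst phi_3_dissection)
    (simp add: negate_X_dilate_odd theta_eq_negate_X_phi)

text \<open>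
  The product of the two dissections \<open>\<phi>(\<plusminus>q) = \<phi>(q^4) \<plusminus> 2 q \<psi>(q^8)\<close> is \<open>\<phi>(-q^2)^2\<close>, which is the claim with
  \<open>q^2\<close> in place of \<open>q\<close>.
\<close>

lemma theta_square: "theta ^ 2 = dilate 2 (phi ^ 2) + fps_X * dilate 2 (- 4 * dilate 2 psi ^ 2)"
proof -
  have "dilate 2 (theta ^ 2) = phi * theta"
    by (simp add: phi_mult_theta)
  also have "\<dots> = dilate 4 phi ^ 2 - 4 * fps_X ^ 2 * dilate 8 psi ^ 2"
    by (subst phi_2_dissection, subst theta_2_dissection) algebra
  also have "\<dots> = dilate 2 (dilate 2 (phi ^ 2) + fps_X * dilate 2 (- 4 * dilate 2 psi ^ 2))"
    by simp
  finally show ?thesis by (simp only: dilate_inject zero_less_numeral)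
qed

lemma phi_square: "phi ^ 2 = dilate 2 phi ^ 2 + 4 * fps_X * dilate 4 psi ^ 2"
proof -
  have "phi = negate_X theta"
    by (simp add: theta_eq_negate_X_phi fps_eq_iff flip: mult.assoc power_mult_distrib)
  then have "phi ^ 2 = negate_X (theta ^ 2)" by simp
  also have "\<dots> = dilate 2 phi ^ 2 + 4 * fps_X * dilate 4 psi ^ 2"
    unfolding theta_square by simp
  finally show ?thesis .
qed

abbreviation Rbar_gf :: "int fps" where
  "Rbar_gf \<equiv> Abs_fps (\<lambda>n. int (Rbar 4 3 n))"

lemma Rbar_gf_eq: "Rbar_gf * theta * dilate 12 theta = dilate 4 theta * dilate 3 theta"
  using Rbar_gf_theta[of 4 3] by (simp add: coprime_iff_gcd_eq_1 gcd_nat.simps)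

lemma theta_cong_1: "fps_cong 2 theta 1"
  unfolding fps_cong_def
proof
  fix n
  have "2 dvd (2 * (\<Sum>k=1..n. (-1) ^ k * fps_X ^ (k\<^sup>2)) :: int fps) $ n"
    by (simp add: numeral_fps_const)
  then show "[theta $ n = 1 $ n] (mod 2)"
    unfolding theta_nth_eq_gauss_partial_sum[OF order_refl] gauss_partial_sum_def
    by (simp add: cong_iff_dvd_diff)
qed

text \<open>
  Since \<open>\<phi>(-q) \<equiv> 1\<close> modulo 2, all theta quotients are trivial modulo 2.
\<close>

lemma even_Rbar: "n > 0 \<Longrightarrow> even (Rbar 4 3 n)"
proof -
  assume n: "n > 0"
  have *: "fps_cong 2 (dilate k theta) 1" if "k > 0" for k
    using fps_cong_dilate[OF theta_cong_1 that] by simp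
  have "fps_cong 2 (Rbar_gf * 1 * 1) (Rbar_gf * theta * dilate 12 theta)"
    by (intro fps_cong_mult fps_cong_refl fps_cong_sym[OF *] fps_cong_sym[OF theta_cong_1]) simp
  also have "Rbar_gf * theta * dilate 12 theta = dilate 4 theta * dilate 3 theta"
    by (rule Rbar_gf_eq)
  also have "fps_cong 2 \<dots> (1 * 1)"
    by (intro fps_cong_mult *) simp_all
  finally have cong: "fps_cong 2 (Rbar_gf * 1 * 1) (1 * 1)" .
  have "[int (Rbar 4 3 n) = 0] (mod 2)"
    using spec[OF cong[unfolded fps_cong_def], of n] n by simp
  then show ?thesis by (simp add: cong_0_iff)
qed

lemma dilate_2_phi_mult_theta: "dilate 2 phi * dilate 2 theta = dilate 4 theta ^ 2"
  using arg_cong[OF phi_mult_theta, of "dilate 2"] by simp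

lemma theta_mult_negate_X_omega_cong:
  "fps_cong 3 (theta * negate_X omega) (dilate 2 (pent * psi))"
  using fps_cong_negate_X[OF phi_mult_omega_cong]
  by (simp add: theta_eq_negate_X_phi del: dilate_mult)

lemma section_3_psi_cube:
  "section_fps 3 2 (dilate 2 psi ^ 3) = 3 * dilate 2 pent ^ 2 * dilate 6 psi"
proof (rule sections_3)
  have psi2: "dilate 2 psi = dilate 6 pent + fps_X ^ 2 * dilate 18 psi"
    by (subst psi_3_dissection) simp
  show "dilate 2 psi ^ 3 = dilate 3 (dilate 2 pent ^ 3 + fps_X ^ 2 * dilate 6 psi ^ 3)
      + fps_X * dilate 3 (3 * fps_X * dilate 2 pent * dilate 6 psi ^ 2)
      + fps_X ^ 2 * dilate 3 (3 * dilate 2 pent ^ 2 * dilate 6 psi)"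
    unfolding psi2 by (simp, algebra)
qed

lemma section_3_phi_cube: "section_fps 3 2 (phi ^ 3) = 12 * dilate 3 phi * omega ^ 2"
proof (rule sections_3)
  show "phi ^ 3 = dilate 3 (dilate 3 phi ^ 3 + 8 * fps_X * omega ^ 3)
      + fps_X * dilate 3 (6 * dilate 3 phi ^ 2 * omega)
      + fps_X ^ 2 * dilate 3 (12 * dilate 3 phi * omega ^ 2)"
    by (subst phi_3_dissection) (simp, algebra)
qed

text \<open>
  Multiplying \<open>1 / \<phi>(-q)\<close> by \<open>\<phi>(q) \<phi>(q^2)^2\<close> turns the denominator into \<open>\<phi>(-q^4)^4\<close>, a series in \<open>q^4\<close>.  The
  exponents congruent to 3 modulo 4 can then be extracted exactly from the 2-dissections of the three
  factors of the numerator.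
\<close>

lemma section_4_Rbar_gf:
  "dilate 3 theta * theta ^ 3 * section_fps 4 3 Rbar_gf
    = 2 * (4 * dilate 2 psi ^ 3 * dilate 3 phi - phi ^ 3 * dilate 6 psi)"
proof -
  let ?F = "dilate 3 theta * phi * dilate 2 phi ^ 2"
  have "dilate 4 theta * (Rbar_gf * dilate 12 theta * dilate 4 theta ^ 3) = dilate 4 theta * ?F"
    using Rbar_gf_eq phi_mult_theta dilate_2_phi_mult_theta by algebra
  moreover have "dilate 4 theta \<noteq> 0"
    using dilate_0[of 4 theta] by fastforce
  ultimately have "Rbar_gf * dilate 12 theta * dilate 4 theta ^ 3 = ?F"
    by simp
  then have F: "dilate 4 (dilate 3 theta * theta ^ 3) * Rbar_gf = ?F"
    by (simp add: ac_simps)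
  have 1: "dilate 3 theta * theta ^ 3 * section_fps 4 3 Rbar_gf = section_fps 4 3 ?F"
    unfolding F[symmetric] by (rule section_dilate_mult[symmetric]) simp
  have t: "dilate 3 theta = dilate 12 phi - 2 * fps_X ^ 3 * dilate 24 psi"
    by (subst theta_2_dissection) simp
  have p: "dilate 2 phi ^ 2 = dilate 4 phi ^ 2 + 4 * fps_X ^ 2 * dilate 8 psi ^ 2"
    using arg_cong[OF phi_square, of "dilate 2"] by simp
  have "section_fps 4 3 ?F = 8 * dilate 2 psi ^ 3 * dilate 3 phi - 2 * phi ^ 3 * dilate 6 psi"
  proof (rule sections_4)
    show "?F = dilate 4 (phi ^ 3 * dilate 3 phi - 4 * fps_X * phi ^ 2 * dilate 2 psi * dilate 6 psi)
      + fps_X * dilate 4 (2 * phi ^ 2 * dilate 2 psi * dilate 3 phi - 8 * fps_X * phi * dilate 2 psi ^ 2 * dilate 6 psi)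
      + fps_X ^ 2 * dilate 4 (4 * phi * dilate 2 psi ^ 2 * dilate 3 phi - 16 * fps_X * dilate 2 psi ^ 3 * dilate 6 psi)
      + fps_X ^ 3 * dilate 4 (8 * dilate 2 psi ^ 3 * dilate 3 phi - 2 * phi ^ 3 * dilate 6 psi)"
      unfolding t p by (subst (1) phi_2_dissection) (simp, algebra)
  qed
  then show ?thesis unfolding 1 by (simp add: algebra_simps)
qed

text \<open>
  By the Frobenius congruence the right side of \<open>section_4_Rbar_gf\<close> is divisible by 3, so one factor
  3 is visible for all arguments \<open>4n + 3\<close>.  Modulo 3 the denominator \<open>\<phi>(-q^3) \<phi>(-q)^3\<close> is a series in \<open>q^3\<close>, so
  the second factor 3 for the arguments \<open>4 (3n + 2) + 3\<close> only requires that the class of 2 modulo 3 in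
  \<open>4 \<psi>(q^2)^3 \<phi>(q^3) - \<phi>(q)^3 \<psi>(q^6)\<close> vanishes modulo 9.  With \<open>P\<close> for \<open>pent\<close> and \<open>\<Omega>\<close> for \<open>omega\<close>, that class is
  \<open>12 (P(q^2)^2 \<psi>(q^6) \<phi>(q) - \<phi>(q^3) \<Omega>(q)^2 \<psi>(q^2))\<close>, and modulo 3 the bracket is
  \<open>\<phi> \<psi>(q^2) ((P \<psi>)(q^2)^2 - (\<phi> \<Omega>)^2)\<close>, which vanishes by \<open>phi_mult_omega_cong\<close>.
\<close>

lemma Rbar_12n_11: "9 dvd Rbar 4 3 (12 * n + 11)"
proof -
  let ?M = "section_fps 4 3 Rbar_gf"
  let ?psi2 = "dilate 2 psi" and ?psi6 = "dilate 6 psi" and ?phi3 = "dilate 3 phi"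
  have psi6: "fps_cong 3 (?psi2 ^ 3) ?psi6"
    using fps_cong_cube[of ?psi2] by simp
  obtain a where a: "?psi2 ^ 3 - ?psi6 = 3 * a"
    using psi6 by (auto simp: fps_cong_3)
  obtain b where b: "phi ^ 3 - ?phi3 = 3 * b"
    using fps_cong_cube[of phi] by (auto simp: fps_cong_3)
  define F where "F = ?psi6 * ?phi3 + 4 * a * ?phi3 - b * ?psi6"
  have F: "4 * ?psi2 ^ 3 * ?phi3 - phi ^ 3 * ?psi6 = 3 * F"
    using a b unfolding F_def by algebra
  have M: "dilate 3 theta * theta ^ 3 * ?M = 2 * (3 * F)"
    unfolding section_4_Rbar_gf F ..
  have "fps_cong 3 (?M * (dilate 3 theta * theta ^ 3)) (0 * (dilate 3 theta * theta ^ 3))"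
    using M by (intro fps_cong_3I[where H = "2 * F"]) algebra
  then have "fps_cong 3 ?M 0" by (rule fps_cong_cancel) (simp add: fps_power_zeroth)
  then obtain M' where M': "?M = 3 * M'"
    by (auto simp: fps_cong_3)
  have "3 * (dilate 3 theta * theta ^ 3 * M') = 3 * (2 * F)"
    using M unfolding M' by algebra
  then have "dilate 3 theta * theta ^ 3 * M' = 2 * F" by (simp only: mult_cancel_left) simp
  have cong: "fps_cong 3 (dilate 3 (theta ^ 2) * M') (2 * F)"
  proof -
    have "fps_cong 3 (dilate 3 theta * dilate 3 theta * M') (dilate 3 theta * theta ^ 3 * M')"
      by (intro fps_cong_mult fps_cong_refl fps_cong_sym[OF fps_cong_cube])
    then show ?thesis
      using \<open>dilate 3 theta * theta ^ 3 * M' = 2 * F\<close> by (simp add: power2_eq_square)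
  qed
  have "fps_cong 3 (section_fps 3 2 F) 0"
  proof -
    have pO: "fps_cong 3 (phi * omega) (dilate 2 pent * ?psi2)"
      using phi_mult_omega_cong by simp
    have "fps_cong 3 (dilate 2 pent ^ 2 * ?psi6 * phi) (dilate 2 pent ^ 2 * ?psi2 ^ 3 * phi)"
      by (intro fps_cong_mult fps_cong_refl fps_cong_sym[OF psi6])
    also have "dilate 2 pent ^ 2 * ?psi2 ^ 3 * phi = (dilate 2 pent * ?psi2) ^ 2 * (?psi2 * phi)"
      by algebra
    also have "fps_cong 3 \<dots> ((phi * omega) ^ 2 * (?psi2 * phi))"
      by (intro fps_cong_mult fps_cong_refl fps_cong_power fps_cong_sym[OF pO])
    also have "(phi * omega) ^ 2 * (?psi2 * phi) = phi ^ 3 * (omega ^ 2 * ?psi2)"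
      by algebra
    also have "fps_cong 3 \<dots> (?phi3 * (omega ^ 2 * ?psi2))"
      by (intro fps_cong_mult fps_cong_refl fps_cong_cube)
    finally obtain K where K: "dilate 2 pent ^ 2 * ?psi6 * phi - ?phi3 * (omega ^ 2 * ?psi2) = 3 * K"
      by (auto simp: fps_cong_3)
    have "3 * section_fps 3 2 F = section_fps 3 2 (3 * F)" by simp
    also have "3 * F = 4 * (?psi2 ^ 3 * dilate 3 phi) - phi ^ 3 * dilate 3 (dilate 2 psi)"
      unfolding F[symmetric] by (simp add: mult.assoc)
    also have "section_fps 3 2 \<dots> = 4 * (section_fps 3 2 (?psi2 ^ 3) * phi) - section_fps 3 2 (phi ^ 3) * dilate 2 psi"
      by (simp only: section_simps section_mult_dilate[of 2 3, simplified])
    also have "\<dots> = 3 * (3 * (4 * K))"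
      unfolding section_3_psi_cube section_3_phi_cube using K by algebra
    finally have "section_fps 3 2 F = 3 * (4 * K)" by (simp only: mult_cancel_left) simp
    then show ?thesis by (intro fps_cong_3I[where H = "4 * K"]) simp
  qed
  then have "fps_cong 3 (2 * section_fps 3 2 F) (2 * 0)"
    by (rule fps_cong_mult[OF fps_cong_refl])
  moreover have "fps_cong 3 (theta ^ 2 * section_fps 3 2 M') (2 * section_fps 3 2 F)"
    using fps_cong_section[OF cong, of 3 2] by (simp add: section_dilate_mult del: dilate_power)
  ultimately have "fps_cong 3 (section_fps 3 2 M' * theta ^ 2) (0 * theta ^ 2)"
    by (auto intro: fps_cong_trans simp: mult.commute)
  then have "fps_cong 3 (section_fps 3 2 M') 0" by (rule fps_cong_cancel) (simp add: fps_power_zeroth)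
  then have "3 dvd M' $ (3 * n + 2)"
    by (simp add: fps_cong_def cong_0_iff)
  moreover have "?M $ (3 * n + 2) = 3 * M' $ (3 * n + 2)"
    unfolding M' by (simp add: numeral_fps_const)
  then have "int (Rbar 4 3 (12 * n + 11)) = 3 * M' $ (3 * n + 2)"
    by (simp add: algebra_simps)
  ultimately have "int 9 dvd int (Rbar 4 3 (12 * n + 11))" by auto
  then show ?thesis by (simp only: of_nat_dvd_iff)
qed

text \<open>
  Since \<open>\<phi>(-q^3) \<equiv> \<phi>(-q)^3\<close> and \<open>\<phi>(-q^12) \<equiv> \<phi>(-q^4)^3\<close>, the generating function collapses modulo 3 to \<open>\<phi>(-q)^2 / \<phi>(-q^4)^2\<close>.
\<close>

lemma Rbar_gf_cong: "fps_cong 3 (Rbar_gf * dilate 4 theta ^ 2) (theta ^ 2)"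
proof (rule fps_cong_cancel)
  have "Rbar_gf * dilate 4 theta ^ 2 * (theta * dilate 4 theta) = Rbar_gf * theta * dilate 4 theta ^ 3"
    by algebra
  also have "fps_cong 3 \<dots> (Rbar_gf * theta * dilate 12 theta)"
    using fps_cong_cube[of "dilate 4 theta"] by (intro fps_cong_mult fps_cong_refl) simp
  also have "\<dots> = dilate 4 theta * dilate 3 theta" by (rule Rbar_gf_eq)
  also have "fps_cong 3 \<dots> (dilate 4 theta * theta ^ 3)"
    by (intro fps_cong_mult fps_cong_refl fps_cong_sym[OF fps_cong_cube])
  also have "\<dots> = theta ^ 2 * (theta * dilate 4 theta)" by algebra
  finally show "fps_cong 3 (Rbar_gf * dilate 4 theta ^ 2 * (theta * dilate 4 theta))
    (theta ^ 2 * (theta * dilate 4 theta))" .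
qed simp

text \<open>
  The denominator \<open>\<phi>(-q^4)^2 = \<phi>(q^2) \<phi>(-q^2)\<close> is a series in \<open>q^2\<close>, so the dissection of \<open>\<phi>(-q)^2\<close> separates
  the parities: \<open>\<phi> / \<phi>(-q)\<close> for even and \<open>-4 \<psi>(q^2)^2 / \<phi>(-q^2)^2\<close> for odd arguments.
\<close>

lemma Rbar_gf_even_cong: "fps_cong 3 (section_fps 2 0 Rbar_gf * theta) phi"
  and Rbar_gf_odd_cong:
    "fps_cong 3 (section_fps 2 1 Rbar_gf * dilate 2 (theta ^ 2)) (dilate 2 (- 4 * psi ^ 2))"
proof -
  have eq: "dilate 4 theta ^ 2 = dilate 2 (phi * theta)"
    using dilate_2_phi_mult_theta by simp
  have *: "fps_cong 3 (section_fps 2 r Rbar_gf * (phi * theta)) (section_fps 2 r (theta ^ 2))"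
    if "r < 2" for r
    using fps_cong_section[OF Rbar_gf_cong, of 2 r] unfolding eq section_mult_dilate[OF that] .
  show "fps_cong 3 (section_fps 2 0 Rbar_gf * theta) phi"
  proof (rule fps_cong_cancel)
    have "fps_cong 3 (section_fps 2 0 Rbar_gf * (phi * theta)) (phi ^ 2)"
      using *[of 0] unfolding sections_2(1)[OF theta_square] by (simp only: zero_less_numeral)
    also have "phi ^ 2 = phi * phi" by (rule power2_eq_square)
    finally show "fps_cong 3 (section_fps 2 0 Rbar_gf * theta * phi) (phi * phi)"
      by (simp only: ac_simps)
  qed simp
  show "fps_cong 3 (section_fps 2 1 Rbar_gf * dilate 2 (theta ^ 2)) (dilate 2 (- 4 * psi ^ 2))"
    using *[of 1] unfolding sections_2(2)[OF theta_square] phi_mult_theta by simp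
qed

lemma Rbar_4n_3: "3 dvd Rbar 4 3 (4 * n + 3)"
proof -
  have "section_fps 2 1 (dilate 2 F) = 0" for F
    using section_X_power_dilate[of 1 2 0 F] by simp
  then have "fps_cong 3 (section_fps 2 1 (section_fps 2 1 Rbar_gf) * theta ^ 2) (0 * theta ^ 2)"
    using fps_cong_section[OF Rbar_gf_odd_cong, of 2 1]
    by (simp add: section_mult_dilate del: dilate_power dilate_mult dilate_simps section_simps)
  then have "fps_cong 3 (section_fps 2 1 (section_fps 2 1 Rbar_gf)) 0"
    by (rule fps_cong_cancel) (simp add: fps_power_zeroth)
  then have "[int (Rbar 4 3 (2 * (2 * n + 1) + 1)) = 0] (mod 3)"
    by (simp add: fps_cong_def)
  moreover have "2 * (2 * n + 1) + 1 = 4 * n + 3" by simp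
  ultimately have "int 3 dvd int (Rbar 4 3 (4 * n + 3))"
    by (simp only: cong_0_iff of_nat_numeral)
  then show ?thesis by (simp only: of_nat_dvd_iff)
qed

text \<open>
  The arguments \<open>4n + 1\<close> have the series \<open>-4 \<psi>^2 / \<phi>(-q)^2\<close>, which modulo 3 is \<open>\<psi>^2 \<phi>(-q)\<close> divided by a series in
  \<open>q^3\<close>, up to sign.  The class of 2 modulo 3 of the numerator is a multiple of
  \<open>\<psi>(q^3) \<phi>(-q^3) - 4 P(q) \<Omega>(-q)\<close>, with \<open>P\<close> for \<open>pent\<close> and \<open>\<Omega>\<close> for \<open>omega\<close>, and this is \<open>-3 P(q) \<Omega>(-q)\<close> by
  \<open>pent_mult_negate_X_omega\<close>.
\<close>

lemma Rbar_12n_9: "3 dvd Rbar 4 3 (12 * n + 9)"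
proof -
  define H where "H = section_fps 2 0 (section_fps 2 1 Rbar_gf)"
  have "section_fps 2 0 (dilate 2 F) = F" for F
    using section_X_power_dilate[of 0 2 0 F] by simp
  then have H: "fps_cong 3 (H * theta ^ 2) (- 4 * psi ^ 2)"
    using fps_cong_section[OF Rbar_gf_odd_cong, of 2 0]
    by (simp add: H_def section_mult_dilate del: dilate_power dilate_mult dilate_simps section_simps)
  have "fps_cong 3 (H * dilate 3 theta) (H * theta ^ 3)"
    by (intro fps_cong_mult fps_cong_refl fps_cong_sym[OF fps_cong_cube])
  also have "H * theta ^ 3 = H * theta ^ 2 * theta" by algebra
  also have "fps_cong 3 \<dots> (- 4 * psi ^ 2 * theta)"
    by (intro fps_cong_mult fps_cong_refl H)
  also have "- 4 * psi ^ 2 * theta = - (4 * (psi ^ 2 * theta))" by simp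
  finally have "fps_cong 3 (section_fps 3 2 (H * dilate 3 theta)) (section_fps 3 2 (- (4 * (psi ^ 2 * theta))))"
    by (rule fps_cong_section)
  then have 1: "fps_cong 3 (section_fps 3 2 H * theta) (- (4 * section_fps 3 2 (psi ^ 2 * theta)))"
    by (simp add: section_mult_dilate)
  have 2: "section_fps 3 2 (psi ^ 2 * theta) = dilate 3 psi ^ 2 * dilate 3 theta - 4 * pent * dilate 3 psi * negate_X omega"
  proof (rule sections_3)
    show "psi ^ 2 * theta = dilate 3 (pent ^ 2 * dilate 3 theta - 2 * fps_X * dilate 3 psi ^ 2 * negate_X omega)
      + fps_X * dilate 3 (2 * pent * dilate 3 psi * dilate 3 theta - 2 * pent ^ 2 * negate_X omega)
      + fps_X ^ 2 * dilate 3 (dilate 3 psi ^ 2 * dilate 3 theta - 4 * pent * dilate 3 psi * negate_X omega)"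
      by (subst psi_3_dissection, subst theta_3_dissection) (simp, algebra)
  qed
  have "section_fps 3 2 (psi ^ 2 * theta) = 3 * (- (dilate 3 psi * pent * negate_X omega))"
    unfolding 2 using pent_mult_negate_X_omega by algebra
  then have "fps_cong 3 (- (4 * section_fps 3 2 (psi ^ 2 * theta))) (0 * theta)"
    by (intro fps_cong_3I[where H = "4 * (dilate 3 psi * pent * negate_X omega)"]) algebra
  with 1 have "fps_cong 3 (section_fps 3 2 H * theta) (0 * theta)" by (rule fps_cong_trans)
  then have "fps_cong 3 (section_fps 3 2 H) 0" by (rule fps_cong_cancel) (simp add: fps_power_zeroth)
  then have "[int (Rbar 4 3 (2 * (2 * (3 * n + 2)) + 1)) = 0] (mod 3)"
    by (simp add: fps_cong_def H_def)
  moreover have "2 * (2 * (3 * n + 2)) + 1 = 12 * n + 9" by simp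
  ultimately have "int 3 dvd int (Rbar 4 3 (12 * n + 9))"
    by (simp only: cong_0_iff of_nat_numeral)
  then show ?thesis by (simp only: of_nat_dvd_iff)
qed

text \<open>
  These are the arguments \<open>2 m\<close> with \<open>m = 3 (3n + 2)\<close>.  Two successive extractions modulo 3 start from
  \<open>\<phi> / \<phi>(-q)\<close>; before each one, the denominator is made a series in \<open>q^3\<close> by multiplying with powers of \<open>\<phi>\<close>
  and \<open>\<phi>(-q)\<close>.  The products \<open>\<phi>(q) \<Omega>(q)\<close> and \<open>\<phi>(-q) \<Omega>(-q)\<close>, with \<open>\<Omega>\<close> for \<open>omega\<close>, are both congruent to the same series
  \<open>K\<close>, because \<open>K\<close> is a series in \<open>q^2\<close>.  Expressed in \<open>K\<close>, the final numerator is \<open>(4 + 32) \<phi>^2 K^2\<close>.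
\<close>

lemma Rbar_18n_12: "3 dvd Rbar 4 3 (18 * n + 12)"
proof -
  define E where "E = section_fps 3 0 (section_fps 2 0 Rbar_gf)"
  define K where "K = dilate 2 (pent * psi)"
  let ?om = "negate_X omega" and ?phi3 = "dilate 3 phi" and ?theta3 = "dilate 3 theta"
  let ?G0 = "section_fps 2 0 Rbar_gf"
  have K1: "fps_cong 3 (phi * omega) K" and K2: "fps_cong 3 (theta * ?om) K"
    using phi_mult_omega_cong theta_mult_negate_X_omega_cong by (simp_all only: K_def)
  have "fps_cong 3 (?G0 * ?theta3) (?G0 * theta ^ 3)"
    by (intro fps_cong_mult fps_cong_refl fps_cong_sym[OF fps_cong_cube])
  also have "?G0 * theta ^ 3 = ?G0 * theta * theta ^ 2" by algebra
  also have "fps_cong 3 \<dots> (phi * theta ^ 2)"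
    by (intro fps_cong_mult fps_cong_refl Rbar_gf_even_cong)
  finally have "fps_cong 3 (section_fps 3 0 (?G0 * ?theta3)) (section_fps 3 0 (phi * theta ^ 2))"
    by (rule fps_cong_section)
  moreover have "section_fps 3 0 (phi * theta ^ 2) = ?phi3 * ?theta3 ^ 2 + 8 * fps_X * omega * ?om ^ 2"
  proof (rule sections_3)
    show "phi * theta ^ 2 = dilate 3 (?phi3 * ?theta3 ^ 2 + 8 * fps_X * omega * ?om ^ 2)
      + fps_X * dilate 3 (2 * omega * ?theta3 ^ 2 - 4 * ?phi3 * ?theta3 * ?om)
      + fps_X ^ 2 * dilate 3 (4 * ?phi3 * ?om ^ 2 - 8 * omega * ?theta3 * ?om)"
      by (subst phi_3_dissection, subst theta_3_dissection) (simp, algebra)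
  qed
  ultimately have E: "fps_cong 3 (E * theta) (?phi3 * ?theta3 ^ 2 + 8 * fps_X * omega * ?om ^ 2)"
    by (simp add: E_def section_mult_dilate)
  have "fps_cong 3 (E * (?theta3 * ?phi3)) (E * (theta ^ 3 * phi ^ 3))"
    by (intro fps_cong_mult fps_cong_refl fps_cong_sym[OF fps_cong_cube])
  also have "E * (theta ^ 3 * phi ^ 3) = E * theta * (theta ^ 2 * phi ^ 3)" by algebra
  also have "fps_cong 3 \<dots> ((?phi3 * ?theta3 ^ 2 + 8 * fps_X * omega * ?om ^ 2) * (theta ^ 2 * phi ^ 3))"
    by (intro fps_cong_mult fps_cong_refl E)
  also have "(?phi3 * ?theta3 ^ 2 + 8 * fps_X * omega * ?om ^ 2) * (theta ^ 2 * phi ^ 3)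
      = ?phi3 * ?theta3 ^ 2 * theta ^ 2 * phi ^ 3 + 8 * fps_X * phi ^ 2 * ((phi * omega) * (theta * ?om) ^ 2)"
    by algebra
  also have "fps_cong 3 \<dots> (?phi3 * ?theta3 ^ 2 * theta ^ 2 * ?phi3 + 8 * fps_X * phi ^ 2 * (K * K ^ 2))"
    by (intro fps_cong_add fps_cong_mult fps_cong_refl fps_cong_power K1 K2 fps_cong_cube)
  also have "K * K ^ 2 = K ^ 3" by algebra
  also have "fps_cong 3 (?phi3 * ?theta3 ^ 2 * theta ^ 2 * ?phi3 + 8 * fps_X * phi ^ 2 * K ^ 3)
      (?phi3 * ?theta3 ^ 2 * theta ^ 2 * ?phi3 + 8 * fps_X * phi ^ 2 * dilate 3 K)"
    by (intro fps_cong_add fps_cong_mult fps_cong_refl fps_cong_cube)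
  also have "\<dots> = dilate 3 (phi ^ 2 * theta ^ 2) * theta ^ 2 + 8 * (dilate 3 K * (fps_X * phi ^ 2))"
    by simp algebra
  also have "E * (?theta3 * ?phi3) = E * dilate 3 (theta * phi)" by simp
  finally have "fps_cong 3 (section_fps 3 2 (E * dilate 3 (theta * phi)))
      (section_fps 3 2 (dilate 3 (phi ^ 2 * theta ^ 2) * theta ^ 2 + 8 * (dilate 3 K * (fps_X * phi ^ 2))))"
    by (rule fps_cong_section)
  also have "section_fps 3 2 (dilate 3 (phi ^ 2 * theta ^ 2) * theta ^ 2 + 8 * (dilate 3 K * (fps_X * phi ^ 2)))
      = phi ^ 2 * theta ^ 2 * section_fps 3 2 (theta ^ 2) + 8 * (K * section_fps 3 2 (fps_X * phi ^ 2))"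
    by (simp add: section_dilate_mult del: dilate_mult dilate_power)
  also have "section_fps 3 2 (theta ^ 2) = 4 * ?om ^ 2"
  proof (rule sections_3)
    show "theta ^ 2 = dilate 3 (?theta3 ^ 2) + fps_X * dilate 3 (- 4 * ?theta3 * ?om)
        + fps_X ^ 2 * dilate 3 (4 * ?om ^ 2)"
      by (subst theta_3_dissection) (simp, algebra)
  qed
  also have "section_fps 3 2 (fps_X * phi ^ 2) = 4 * ?phi3 * omega"
  proof (rule sections_3)
    show "fps_X * phi ^ 2 = dilate 3 (4 * fps_X * omega ^ 2) + fps_X * dilate 3 (?phi3 ^ 2)
        + fps_X ^ 2 * dilate 3 (4 * ?phi3 * omega)"
      by (subst phi_3_dissection) (simp, algebra)
  qed
  also have "phi ^ 2 * theta ^ 2 * (4 * ?om ^ 2) + 8 * (K * (4 * ?phi3 * omega))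
      = 4 * phi ^ 2 * (theta * ?om) ^ 2 + 32 * K * (?phi3 * omega)"
    by algebra
  also have "fps_cong 3 \<dots> (4 * phi ^ 2 * (theta * ?om) ^ 2 + 32 * K * (phi ^ 3 * omega))"
    by (intro fps_cong_add fps_cong_mult fps_cong_refl fps_cong_sym[OF fps_cong_cube])
  also have "phi ^ 3 * omega = phi ^ 2 * (phi * omega)" by algebra
  also have "fps_cong 3 (4 * phi ^ 2 * (theta * ?om) ^ 2 + 32 * K * (phi ^ 2 * (phi * omega)))
      (4 * phi ^ 2 * K ^ 2 + 32 * K * (phi ^ 2 * K))"
    by (intro fps_cong_add fps_cong_mult fps_cong_refl fps_cong_power K1 K2)
  also have "4 * phi ^ 2 * K ^ 2 + 32 * K * (phi ^ 2 * K) = 3 * (12 * phi ^ 2 * K ^ 2)"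
    by algebra
  also have "fps_cong 3 \<dots> (0 * (theta * phi))"
    by (rule fps_cong_3I[where H = "12 * phi ^ 2 * K ^ 2"]) simp
  also have "section_fps 3 2 (E * dilate 3 (theta * phi)) = section_fps 3 2 E * (theta * phi)"
    by (rule section_mult_dilate) simp
  finally have "fps_cong 3 (section_fps 3 2 E) 0" by (rule fps_cong_cancel) (simp add: fps_power_zeroth)
  then have "[int (Rbar 4 3 (2 * (3 * (3 * n + 2)))) = 0] (mod 3)"
    by (simp add: fps_cong_def E_def)
  moreover have "2 * (3 * (3 * n + 2)) = 18 * n + 12" by simp
  ultimately have "int 3 dvd int (Rbar 4 3 (18 * n + 12))"
    by (simp only: cong_0_iff of_nat_numeral)
  then show ?thesis by (simp only: of_nat_dvd_iff)
qed

theorem theorem4p2: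
  fixes n :: nat
  shows "[Rbar 4 3 (9 * n + 3) = 0] (mod 6) \<and> [Rbar 4 3 (12 * n + 11) = 0] (mod 9)"
proof
  let ?k = "9 * n + 3"
  consider m where "n = 2 * m + 1" | m where "n = 2 * (2 * m)" | m where "n = 2 * (2 * m + 1)"
    by (metis evenE oddE)
  then have "3 dvd Rbar 4 3 ?k"
  proof cases
    case (1 m)
    then have "?k = 18 * m + 12" by simp
    then show ?thesis by (simp only: Rbar_18n_12)
  next
    case (2 m)
    then have "?k = 4 * (9 * m) + 3" by simp
    then show ?thesis by (simp only: Rbar_4n_3)
  next
    case (3 m)
    then have "?k = 12 * (3 * m + 1) + 9" by simp
    then show ?thesis by (simp only: Rbar_12n_9)
  qed
  moreover have "2 dvd Rbar 4 3 ?k"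
    by (rule even_Rbar) simp
  moreover have "coprime (2 :: nat) 3"
    by (simp add: coprime_iff_gcd_eq_1 gcd_nat.simps)
  ultimately have "2 * 3 dvd Rbar 4 3 ?k"
    by (intro divides_mult)
  then show "[Rbar 4 3 ?k = 0] (mod 6)"
    by (simp add: cong_0_iff)
  show "[Rbar 4 3 (12 * n + 11) = 0] (mod 9)"
    using Rbar_12n_11 by (simp add: cong_0_iff)
qed

end
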